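(* For each countable ordinal $\alpha$ and each $k\in\omega$, the set $\mathrm{LT}_{<\omega\alpha+k+1}=\{T\in\mathrm{Tr}: |T|<\omega\alpha+k+1\}$ is $\mathbf{\Pi}^0_{2\alpha+2}$-complete.
   Context: $\omega=\{0,1,2,\dots\}$. $\mathrm{Tr}$ is the space of all trees on $\omega$, i.e. subsets $T\subseteq\omega^{<\omega}$ closed downwards under initial segments and containing the empty sequence $\emptyset$, with the Polish topology inherited from the product space $2^{\omega^{<\omega}}$. The Lusin derivative of $T\in\mathrm{Tr}$ is $D(T)=\{s\in\omega^{<\omega}:\exists n\in\omega\ (s*(n)\in T)\}\cup\{\emptyset\}$, where $*$ denotes concatenation of finite sequences. Iterates: $D^0(T)=T$, $D^{\alpha+1}(T)=D(D^\alpha(T))$, and $D^\alpha(T)=\bigcap_{\xi<\alpha}D^\xi(T)$ for limit $\alpha$. The Lusin height $|T|$ is the least ordinal $\alpha$ with $D^{\alpha+1}(T)=D^\alpha(T)$ (it is countable). Ordinal products are standard ordinal multiplication, $\omega\alpha=\omega\cdot\alpha$, $2\alpha=2\cdot\alpha$ (so $2\lambda=\lambda$ for limit $\lambda$). For a Polish space $Y$, $B\subseteq Y$ is $\mathbf{\Pi}^0_\xi$-hard if for every zero-dimensional Polish space $X$ and every $\mathbf{\Pi}^0_\xi$ set $A\subseteq X$ there is a continuous $f:X\to Y$ with $f^{-1}(B)=A$; $B$ is $\mathbf{\Pi}^0_\xi$-complete if it is $\mathbf{\Pi}^0_\xi$ and $\mathbf{\Pi}^0_\xi$-hard. *)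

theory Defs
  imports "HOL-Analysis.Analysis"
begin

text \<open>The ordinals below \<open>\<omega>\<^sub>1\<close>, i.e. the countable ordinals, are realized as the points of the
  well-order \<^term>\<open>cardSuc natLeq\<close> of type \<open>\<omega>\<^sub>1\<close>, the point \<open>\<alpha>\<close> standing for the order type of
  the set of its predecessors. The lemmas \<open>countable_lessThan_ord\<close> and \<open>uncountable_UNIV_ord\<close>
  below say that the order type is indeed \<open>\<omega>\<^sub>1\<close>.\<close>

lemma Card_order_omega1: "Card_order (cardSuc natLeq)"
  by (rule cardSuc_Card_order[OF natLeq_Card_order])

lemma Well_order_omega1: "Well_order (cardSuc natLeq)"
  using Card_order_omega1 by (simp add: card_order_on_well_order_on)

lemma Field_omega1_nonempty: "Field (cardSuc natLeq) \<noteq> {}"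
proof -
  have "\<not> finite (Field (cardSuc natLeq))"
    using Cinfinite_cardSuc[of natLeq] natLeq_Cinfinite by (auto simp: cinfinite_def)
  then show ?thesis by auto
qed

typedef countable_ord = "Field (cardSuc natLeq)"
  using Field_omega1_nonempty by blast

instantiation countable_ord :: wellorder
begin

definition less_eq_countable_ord :: "countable_ord \<Rightarrow> countable_ord \<Rightarrow> bool" where
  "\<alpha> \<le> \<beta> \<longleftrightarrow> (Rep_countable_ord \<alpha>, Rep_countable_ord \<beta>) \<in> cardSuc natLeq"

definition less_countable_ord :: "countable_ord \<Rightarrow> countable_ord \<Rightarrow> bool" where
  "(\<alpha>::countable_ord) < \<beta> \<longleftrightarrow> \<alpha> \<le> \<beta> \<and> \<not> \<beta> \<le> \<alpha>"

instance
proof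
  let ?r = "cardSuc natLeq"
  have lin: "linear_order_on (Field ?r) ?r" and wf: "wf (?r - Id)"
    using Well_order_omega1 by (auto simp: well_order_on_def)
  have R: "refl_on (Field ?r) ?r" "trans ?r" "antisym ?r" "total_on (Field ?r) ?r"
    using lin by (auto simp: order_on_defs)
  fix x y z :: countable_ord
  show "(x < y) = (x \<le> y \<and> \<not> y \<le> x)" by (rule less_countable_ord_def)
  show refl: "x \<le> x"
    using R(1) Rep_countable_ord by (auto simp: less_eq_countable_ord_def refl_on_def)
  show "x \<le> y \<Longrightarrow> y \<le> z \<Longrightarrow> x \<le> z"
    using R(2) by (auto simp: less_eq_countable_ord_def dest: transD)
  show "x \<le> y \<Longrightarrow> y \<le> x \<Longrightarrow> x = y"
    using R(3) Rep_countable_ord_inject by (auto simp: less_eq_countable_ord_def dest: antisymD)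
  show "x \<le> y \<or> y \<le> x"
    using R(4) Rep_countable_ord[of x] Rep_countable_ord[of y] refl
    by (cases "x = y") (auto simp: less_eq_countable_ord_def total_on_def Rep_countable_ord_inject)
next
  fix P :: "countable_ord \<Rightarrow> bool" and a
  assume step: "\<And>x. (\<And>y. y < x \<Longrightarrow> P y) \<Longrightarrow> P x"
  let ?r = "cardSuc natLeq"
  have wf: "wf (?r - Id)"
    using Well_order_omega1 by (auto simp: well_order_on_def)
  have "wf (inv_image (?r - Id) Rep_countable_ord)"
    using wf by (rule wf_inv_image)
  then show "P a"
  proof (induction a rule: wf_induct_rule)
    case (less x)
    show ?case
    proof (rule step)
      fix y assume "y < x"
      then have "(y, x) \<in> inv_image (?r - Id) Rep_countable_ord"
        by (auto simp: less_countable_ord_def less_eq_countable_ord_def)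
      then show "P y" by (rule less.IH)
    qed
  qed
qed

end

lemma countable_iff_ordLeq_natLeq: "countable A \<longleftrightarrow> (card_of A, natLeq) \<in> ordLeq"
proof -
  have "(card_of A, natLeq) \<in> ordLeq \<longleftrightarrow> (card_of A, card_of (UNIV :: nat set)) \<in> ordLeq"
    using card_of_nat ordIso_symmetric ordLeq_ordIso_trans by blast
  then show ?thesis by (simp add: countable_def flip: card_of_ordLeq)
qed

lemma countable_lessThan_ord: "countable {..<\<alpha>::countable_ord}"
proof -
  include cardinal_syntax
  let ?r = "cardSuc natLeq"
  have "|underS ?r (Rep_countable_ord \<alpha>)| <o ?r"
    using card_of_underS[OF Card_order_omega1 Rep_countable_ord] .
  then have "|underS ?r (Rep_countable_ord \<alpha>)| \<le>o natLeq"
    using cardSuc_ordLeq_ordLess[OF natLeq_Card_order card_of_Card_order] by blast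
  then have "countable (underS ?r (Rep_countable_ord \<alpha>))"
    by (simp add: countable_iff_ordLeq_natLeq)
  moreover have "Rep_countable_ord ` {..<\<alpha>} \<subseteq> underS ?r (Rep_countable_ord \<alpha>)"
    by (auto simp: underS_def less_countable_ord_def less_eq_countable_ord_def)
  ultimately have "countable (Rep_countable_ord ` {..<\<alpha>})"
    using countable_subset by blast
  then show ?thesis
    by (rule countable_image_inj_on) (meson Rep_countable_ord_inject inj_onI)
qed

lemma uncountable_UNIV_ord: "uncountable (UNIV :: countable_ord set)"
proof
  include cardinal_syntax
  let ?r = "cardSuc natLeq"
  assume "countable (UNIV :: countable_ord set)"
  then have "countable (range Rep_countable_ord)" by (rule countable_image)
  then have "countable (Field ?r)"
    using type_definition.Rep_range[OF type_definition_countable_ord] by simp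
  then have "|Field ?r| \<le>o natLeq" by (simp add: countable_iff_ordLeq_natLeq)
  moreover have "|Field ?r| =o ?r" using Card_order_omega1 by (rule card_of_Field_ordIso)
  ultimately have "?r \<le>o natLeq" using ordIso_ordLeq_trans ordIso_symmetric by blast
  moreover have "natLeq <o ?r" by (rule cardSuc_greater[OF natLeq_Card_order])
  ultimately show False using not_ordLess_ordLeq by blast
qed

definition ord_succ :: "countable_ord \<Rightarrow> countable_ord" where
  "ord_succ \<alpha> = (LEAST \<beta>. \<alpha> < \<beta>)"

definition ord_Sup :: "countable_ord set \<Rightarrow> countable_ord" where
  "ord_Sup A = (LEAST \<beta>. \<forall>\<alpha>\<in>A. \<alpha> \<le> \<beta>)"

lemma countable_ord_bounded:
  assumes "countable (A :: countable_ord set)"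
  shows "\<exists>\<beta>. \<forall>\<alpha>\<in>A. \<alpha> < \<beta>"
proof (rule ccontr)
  assume "\<not> ?thesis"
  then have "UNIV = (\<Union>\<alpha>\<in>A. insert \<alpha> {..<\<alpha>})"
    by (auto simp: not_less le_less)
  moreover have "countable (\<Union>\<alpha>\<in>A. insert \<alpha> {..<\<alpha>})"
    using assms countable_lessThan_ord by auto
  ultimately show False using uncountable_UNIV_ord by simp
qed

lemma ord_succ_greater: "\<alpha> < ord_succ \<alpha>"
  unfolding ord_succ_def using countable_ord_bounded[of "{\<alpha>}"] by (auto intro: LeastI_ex)

lemma ord_succ_le_iff: "ord_succ \<alpha> \<le> \<beta> \<longleftrightarrow> \<alpha> < \<beta>"
  using ord_succ_greater[of \<alpha>] unfolding ord_succ_def by (auto intro: Least_le)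

lemma ord_succ_inject: "ord_succ \<alpha> = ord_succ \<beta> \<longleftrightarrow> \<alpha> = \<beta>"
  by (metis ord_succ_greater ord_succ_le_iff linorder_neqE order_less_le_trans less_irrefl)

lemma ord_Sup_le_iff:
  assumes "countable A"
  shows "ord_Sup A \<le> \<beta> \<longleftrightarrow> (\<forall>\<alpha>\<in>A. \<alpha> \<le> \<beta>)"
proof -
  have "\<exists>\<beta>. \<forall>\<alpha>\<in>A. \<alpha> \<le> \<beta>"
    using countable_ord_bounded[OF assms] by (meson less_imp_le)
  then have "\<forall>\<alpha>\<in>A. \<alpha> \<le> ord_Sup A"
    unfolding ord_Sup_def by (rule LeastI_ex)
  moreover have "ord_Sup A \<le> \<beta>" if "\<forall>\<alpha>\<in>A. \<alpha> \<le> \<beta>"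
    unfolding ord_Sup_def using that by (rule Least_le)
  ultimately show ?thesis by (blast intro: order_trans)
qed

instantiation countable_ord :: "{zero, one}"
begin

definition zero_countable_ord :: countable_ord where
  "0 = (LEAST \<alpha>::countable_ord. True)"

definition one_countable_ord :: countable_ord where
  "1 = ord_succ (0::countable_ord)"

instance ..

end

lemma ord_zero_le: "0 \<le> (\<alpha>::countable_ord)"
  unfolding zero_countable_ord_def by (rule Least_le) simp

definition ord_limit :: "countable_ord \<Rightarrow> bool" where
  "ord_limit \<alpha> \<longleftrightarrow> \<alpha> \<noteq> 0 \<and> (\<forall>\<beta>. \<alpha> \<noteq> ord_succ \<beta>)"

function ord_rec :: "'a \<Rightarrow> ('a \<Rightarrow> 'a) \<Rightarrow> ('a set \<Rightarrow> 'a) \<Rightarrow> countable_ord \<Rightarrow> 'a" where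
  "ord_rec z s l \<alpha> =
     (if \<alpha> = 0 then z
      else if \<exists>\<beta>. \<alpha> = ord_succ \<beta> then s (ord_rec z s l (THE \<beta>. \<alpha> = ord_succ \<beta>))
      else l (ord_rec z s l ` {\<beta>. \<beta> < \<alpha>}))"
  by auto
termination
proof (relation "inv_image {(\<alpha>, \<beta>). \<alpha> < \<beta>} (\<lambda>(z, s, l, \<alpha>). \<alpha>)", goal_cases)
  case 1
  show ?case using wf by (rule wf_inv_image)
next
  case (2 z s l \<alpha>)
  then obtain \<beta> where "\<alpha> = ord_succ \<beta>" by blast
  then show ?case by (simp add: ord_succ_inject ord_succ_greater)
next
  case (3 z s l \<alpha> \<beta>)
  then show ?case by simp
qed

declare ord_rec.simps [simp del]

lemma ord_rec_0: "ord_rec z s l 0 = z"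
  by (simp add: ord_rec.simps[of z s l 0])

lemma ord_rec_succ: "ord_rec z s l (ord_succ \<alpha>) = s (ord_rec z s l \<alpha>)"
proof -
  have "ord_succ \<alpha> \<noteq> 0"
    using ord_succ_greater[of \<alpha>] ord_zero_le[of \<alpha>] by auto
  then show ?thesis
    by (simp add: ord_rec.simps[of z s l "ord_succ \<alpha>"] ord_succ_inject)
qed

lemma ord_rec_limit:
  "ord_limit \<alpha> \<Longrightarrow> ord_rec z s l \<alpha> = l (ord_rec z s l ` {..<\<alpha>})"
  by (simp add: ord_rec.simps[of z s l \<alpha>] ord_limit_def lessThan_def)

instantiation countable_ord :: "{plus, times}"
begin

definition plus_countable_ord :: "countable_ord \<Rightarrow> countable_ord \<Rightarrow> countable_ord" where
  "\<alpha> + \<beta> = ord_rec \<alpha> ord_succ ord_Sup \<beta>"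

definition times_countable_ord :: "countable_ord \<Rightarrow> countable_ord \<Rightarrow> countable_ord" where
  "\<alpha> * \<beta> = ord_rec 0 (\<lambda>\<gamma>. \<gamma> + \<alpha>) ord_Sup \<beta>"

instance ..

end

definition ord_of_nat :: "nat \<Rightarrow> countable_ord" where
  "ord_of_nat n = (ord_succ ^^ n) 0"

definition ord_omega :: countable_ord where
  "ord_omega = ord_Sup (range ord_of_nat)"

definition Polish_space :: "'a topology \<Rightarrow> bool" where
  "Polish_space X \<longleftrightarrow> completely_metrizable_space X \<and> separable_space X"

definition zero_dimensional_space :: "'a topology \<Rightarrow> bool" where
  "zero_dimensional_space X \<longleftrightarrow>
     (\<forall>U x. openin X U \<and> x \<in> U \<longrightarrow> (\<exists>V. openin X V \<and> closedin X V \<and> x \<in> V \<and> V \<subseteq> U))"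

text \<open>\<open>Borel_Sigma X \<xi>\<close> and \<open>Borel_Pi X \<xi>\<close> are the boldface additive and multiplicative classes
  \<open>\<Sigma>\<^sup>0\<^sub>\<xi>(X)\<close> and \<open>\<Pi>\<^sup>0\<^sub>\<xi>(X)\<close> for \<open>1 \<le> \<xi> < \<omega>\<^sub>1\<close>; both are empty for \<open>\<xi> = 0\<close>.\<close>

inductive Borel_Sigma :: "'a topology \<Rightarrow> countable_ord \<Rightarrow> 'a set \<Rightarrow> bool"
  and Borel_Pi :: "'a topology \<Rightarrow> countable_ord \<Rightarrow> 'a set \<Rightarrow> bool"
  for X :: "'a topology" where
  Sigma_open: "openin X U \<Longrightarrow> Borel_Sigma X 1 U"
| Sigma_Union: "1 < \<xi> \<Longrightarrow> (\<And>n::nat. 1 \<le> \<eta> n \<and> \<eta> n < \<xi>) \<Longrightarrow> (\<And>n. Borel_Pi X (\<eta> n) (A n)) \<Longrightarrow>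
    Borel_Sigma X \<xi> (\<Union>n. A n)"
| Pi_compl: "Borel_Sigma X \<xi> A \<Longrightarrow> Borel_Pi X \<xi> (topspace X - A)"

text \<open>HOL cannot quantify over types inside a formula, so the type on which the test spaces \<open>X\<close>
  live is a parameter. A statement with a free type variable \<open>'x\<close> in this position
  covers all zero-dimensional Polish spaces.\<close>

definition Borel_Pi_hard ::
  "'x itself \<Rightarrow> 'a topology \<Rightarrow> countable_ord \<Rightarrow> 'a set \<Rightarrow> bool" where
  "Borel_Pi_hard _ Y \<xi> B \<longleftrightarrow>
     (\<forall>(X :: 'x topology) A. Polish_space X \<and> zero_dimensional_space X \<and> Borel_Pi X \<xi> A \<longrightarrow>
        (\<exists>f. continuous_map X Y f \<and> {x \<in> topspace X. f x \<in> B} = A))"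

definition Borel_Pi_complete ::
  "'x itself \<Rightarrow> 'a topology \<Rightarrow> countable_ord \<Rightarrow> 'a set \<Rightarrow> bool" where
  "Borel_Pi_complete TX Y \<xi> B \<longleftrightarrow> Borel_Pi Y \<xi> B \<and> Borel_Pi_hard TX Y \<xi> B"

definition Trees :: "nat list set set" where
  "Trees = {T. [] \<in> T \<and> (\<forall>s t. s @ t \<in> T \<longrightarrow> s \<in> T)}"

text \<open>Sets of finite sequences are identified with their characteristic functions, i.e. with points
  of the product space \<open>2\<^bsup>\<omega>\<^sup><\<^sup>\<omega>\<^esup>\<close>.\<close>

definition tree_topology :: "nat list set topology" where
  "tree_topology = pullback_topology Trees (\<lambda>T s. s \<in> T)
     (product_topology (\<lambda>_. discrete_topology (UNIV :: bool set)) UNIV)"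

lemma topspace_tree_topology: "topspace tree_topology = Trees"
  by (auto simp: tree_topology_def topspace_pullback_topology)

definition Lusin_derivative :: "nat list set \<Rightarrow> nat list set" where
  "Lusin_derivative T = {s. \<exists>n. s @ [n] \<in> T} \<union> {[]}"

definition Lusin_iterate :: "countable_ord \<Rightarrow> nat list set \<Rightarrow> nat list set" where
  "Lusin_iterate \<alpha> T = ord_rec T Lusin_derivative Inter \<alpha>"

definition Lusin_height :: "nat list set \<Rightarrow> countable_ord" where
  "Lusin_height T = (LEAST \<alpha>. Lusin_iterate (\<alpha> + 1) T = Lusin_iterate \<alpha> T)"

lemma Lusin_derivative_tree:
  assumes "T \<in> Trees"
  shows "Lusin_derivative T \<subseteq> T" "Lusin_derivative T \<in> Trees"
proof -
  have sub: "s \<in> T" if "s @ t \<in> T" for s t using assms that by (auto simp: Trees_def)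
  show "Lusin_derivative T \<subseteq> T"
    using assms sub unfolding Lusin_derivative_def Trees_def by blast
  have "s \<in> Lusin_derivative T" if st: "s @ t \<in> Lusin_derivative T" for s t
  proof (cases "s @ t = []")
    case False
    then obtain n where "s @ t @ [n] \<in> T"
      using st by (auto simp: Lusin_derivative_def)
    then obtain m u where "s @ m # u \<in> T" by (cases "t @ [n]") auto
    then have "s @ [m] \<in> T" using sub[of "s @ [m]" u] by simp
    then show ?thesis by (auto simp: Lusin_derivative_def)
  qed (simp add: Lusin_derivative_def)
  moreover have "[] \<in> Lusin_derivative T" by (simp add: Lusin_derivative_def)
  ultimately show "Lusin_derivative T \<in> Trees" unfolding Trees_def by blast
qed

lemma Lusin_iterate_0: "Lusin_iterate 0 T = T"
  by (simp add: Lusin_iterate_def ord_rec_0)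

lemma Lusin_iterate_succ:
  "Lusin_iterate (\<alpha> + 1) T = Lusin_derivative (Lusin_iterate \<alpha> T)"
  by (simp add: Lusin_iterate_def plus_countable_ord_def one_countable_ord_def ord_rec_succ
      ord_rec_0)

lemma Lusin_iterate_limit:
  "ord_limit \<alpha> \<Longrightarrow> Lusin_iterate \<alpha> T = (\<Inter>\<xi>\<in>{..<\<alpha>}. Lusin_iterate \<xi> T)"
  by (simp add: Lusin_iterate_def ord_rec_limit)

lemma ord_add_1: "\<alpha> + 1 = ord_succ \<alpha>"
  by (simp add: plus_countable_ord_def one_countable_ord_def ord_rec_succ ord_rec_0)

lemma Lusin_iterate_tree:
  assumes "T \<in> Trees"
  shows "Lusin_iterate \<beta> T \<in> Trees \<and> (\<forall>\<alpha>\<le>\<beta>. Lusin_iterate \<beta> T \<subseteq> Lusin_iterate \<alpha> T)"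
proof (induction \<beta> rule: less_induct)
  case (less \<beta>)
  consider "\<beta> = 0" | \<gamma> where "\<beta> = \<gamma> + 1" | "ord_limit \<beta>"
    by (auto simp: ord_limit_def ord_add_1)
  then show ?case
  proof cases
    case 1
    then show ?thesis
      using assms ord_zero_le by (metis Lusin_iterate_0 order_antisym order_refl)
  next
    case (2 \<gamma>)
    have "\<gamma> < \<beta>" using 2 ord_succ_greater by (simp add: ord_add_1)
    note IH = less.IH[OF this]
    have sub: "Lusin_iterate \<beta> T \<subseteq> Lusin_iterate \<gamma> T" "Lusin_iterate \<beta> T \<in> Trees"
      using Lusin_derivative_tree[of "Lusin_iterate \<gamma> T"] IH
      by (simp_all add: 2 Lusin_iterate_succ)
    have "\<alpha> = \<beta> \<or> \<alpha> \<le> \<gamma>" if "\<alpha> \<le> \<beta>" for \<alpha>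
      using that 2 ord_succ_le_iff[of \<gamma> \<alpha>] by (auto simp: ord_add_1)
    then show ?thesis using sub IH by blast
  next
    case 3
    have "Lusin_iterate \<beta> T \<in> Trees"
      using less.IH unfolding Lusin_iterate_limit[OF 3] Trees_def by blast
    moreover have "Lusin_iterate \<beta> T \<subseteq> Lusin_iterate \<alpha> T" if "\<alpha> < \<beta>" for \<alpha>
      using that unfolding Lusin_iterate_limit[OF 3] by blast
    ultimately show ?thesis by (auto simp: le_less)
  qed
qed

text \<open>The least ordinal in the definition of the height exists, since \<open>\<omega>\<^sup><\<^sup>\<omega>\<close> is countable.\<close>

lemma Lusin_height_stable:
  assumes "T \<in> Trees"
  shows "Lusin_iterate (Lusin_height T + 1) T = Lusin_iterate (Lusin_height T) T"
proof -
  have "\<exists>\<alpha>. Lusin_iterate (\<alpha> + 1) T = Lusin_iterate \<alpha> T"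
  proof (rule ccontr)
    assume "\<not> ?thesis"
    then have "\<exists>s. s \<in> Lusin_iterate \<alpha> T - Lusin_iterate (\<alpha> + 1) T" for \<alpha>
      using Lusin_derivative_tree(1)[of "Lusin_iterate \<alpha> T"] Lusin_iterate_tree[OF assms, of \<alpha>]
      by (auto simp: Lusin_iterate_succ)
    then obtain f where f: "f \<alpha> \<in> Lusin_iterate \<alpha> T - Lusin_iterate (\<alpha> + 1) T" for \<alpha>
      by metis
    have "f \<alpha> \<noteq> f \<beta>" if "\<alpha> < \<beta>" for \<alpha> \<beta>
    proof -
      have "\<alpha> + 1 \<le> \<beta>" using that by (simp add: ord_add_1 ord_succ_le_iff)
      then have "Lusin_iterate \<beta> T \<subseteq> Lusin_iterate (\<alpha> + 1) T"
        using Lusin_iterate_tree[OF assms] by blast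
      then show ?thesis using f[of \<alpha>] f[of \<beta>] by auto
    qed
    then have "inj f" by (metis injI linorder_neqE)
    moreover have "countable (range f)" by simp
    ultimately show False
      using uncountable_UNIV_ord countable_image_inj_on[of f UNIV] by simp
  qed
  then show ?thesis unfolding Lusin_height_def by (rule LeastI_ex)
qed

definition LT_less :: "countable_ord \<Rightarrow> nat list set set" where
  "LT_less \<beta> = {T \<in> Trees. Lusin_height T < \<beta>}"

end

theory Submission
  imports Defs
begin

text \<open>A node \<open>s \<noteq> \<emptyset>\<close> lies in \<open>D\<^sup>\<xi>(T)\<close> iff its rank is at least \<open>\<xi>\<close>, so \<open>|T| \<le> \<gamma>\<close> says that every
  nonempty node of rank \<open>\<ge> \<gamma>\<close> has rank \<open>\<ge> \<gamma> + 1\<close>. Rank \<open>\<ge> \<omega>\<alpha>\<close> is a \<open>\<Pi>\<^sup>0\<^sub>2\<^sub>\<alpha>\<close> condition (clopen for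
  \<open>\<alpha> = 0\<close>), because it means: for all \<open>\<beta> < \<alpha>\<close> and \<open>n\<close> there is an \<open>n\<close>-th generation descendant
  of rank \<open>\<ge> \<omega>\<beta>\<close>. This gives the upper bound.

  For hardness, every \<open>\<Pi>\<^sup>0\<^sub>2\<^sub>\<alpha>\<close> set \<open>C\<close> is reduced by a continuous map \<open>x \<mapsto> T(x)\<close> to the set of
  ill-founded trees, in such a way that each node of \<open>T(x)\<close> is ill-founded or of rank \<open>< \<omega>\<alpha>\<close>.
  If \<open>C\<close> is the intersection over \<open>n\<close> of the unions of sets \<open>C\<^sub>n\<^sub>m\<close> of lower classes, a branch of the
  new tree chooses for each \<open>n\<close> an \<open>m\<close> together with a branch of the tree of \<open>C\<^sub>n\<^sub>m\<close>; the rank of a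
  node is bounded by the ranks of its components, so a failure at \<open>n\<close> only costs finitely many
  further levels. Finally, each union in a \<open>\<Pi>\<^sup>0\<^sub>2\<^sub>\<alpha>\<^sub>+\<^sub>2\<close> set gets a node that carries the trees of its
  members and a fixed tree of rank \<open>\<omega>\<alpha> + k\<close>: that node has rank exactly \<open>\<omega>\<alpha> + k\<close> if \<open>x\<close> is not in
  the union, and is ill-founded otherwise.\<close>

section \<open>Arithmetic of countable ordinals\<close>

lemma less_ord_succ_iff: "\<beta> < ord_succ \<alpha> \<longleftrightarrow> \<beta> \<le> \<alpha>"
  by (metis not_less ord_succ_le_iff)

lemma ord_not_less_zero [simp]: "\<not> \<alpha> < (0::countable_ord)"
  by (simp add: not_less ord_zero_le)

lemma ord_le_zero [simp]: "\<alpha> \<le> (0::countable_ord) \<longleftrightarrow> \<alpha> = 0"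
  using ord_zero_le[of \<alpha>] order_antisym by blast

lemma ord_cases:
  obtains "\<alpha> = 0" | \<beta> where "\<alpha> = ord_succ \<beta>" | "ord_limit \<alpha>"
  by (auto simp: ord_limit_def)

lemma ord_gr_zero_iff: "0 < (\<alpha>::countable_ord) \<longleftrightarrow> \<alpha> \<noteq> 0"
  using ord_zero_le[of \<alpha>] by (auto simp: less_le)

lemma less_ord_Sup_iff: "countable A \<Longrightarrow> \<beta> < ord_Sup A \<longleftrightarrow> (\<exists>\<alpha>\<in>A. \<beta> < \<alpha>)"
  using ord_Sup_le_iff[of A \<beta>] by (metis not_le)

lemma ord_limit_succ_less: "ord_limit \<alpha> \<Longrightarrow> \<beta> < \<alpha> \<Longrightarrow> ord_succ \<beta> < \<alpha>"
  using ord_succ_le_iff[of \<beta> \<alpha>] by (force simp: ord_limit_def le_less)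

lemma ord_add_simps [simp]:
  "\<alpha> + 0 = (\<alpha> :: countable_ord)" "\<alpha> + ord_succ \<beta> = ord_succ (\<alpha> + \<beta>)"
  by (simp_all add: plus_countable_ord_def ord_rec_0 ord_rec_succ)

lemma ord_add_limit: "ord_limit \<beta> \<Longrightarrow> \<alpha> + \<beta> = ord_Sup ((+) \<alpha> ` {..<\<beta>})"
  by (simp add: plus_countable_ord_def ord_rec_limit image_def)

lemma ord_mult_simps [simp]:
  "\<alpha> * 0 = (0 :: countable_ord)" "\<alpha> * ord_succ \<beta> = \<alpha> * \<beta> + \<alpha>"
  by (simp_all add: times_countable_ord_def ord_rec_0 ord_rec_succ)

lemma ord_mult_limit: "ord_limit \<beta> \<Longrightarrow> \<alpha> * \<beta> = ord_Sup ((*) \<alpha> ` {..<\<beta>})"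
  by (simp add: times_countable_ord_def ord_rec_limit image_def)

lemma countable_image_lessThan_ord: "countable (f ` {..<\<alpha>::countable_ord})"
  by (simp add: countable_lessThan_ord)

lemma ord_add_of_nat: "\<alpha> + ord_of_nat n = (ord_succ ^^ n) \<alpha>"
  by (induction n) (simp_all add: ord_of_nat_def)

lemma ord_le_add: "\<alpha> \<le> \<alpha> + (\<beta>::countable_ord)"
proof (induction \<beta> rule: less_induct)
  case (less \<beta>)
  show ?case
  proof (cases \<beta> rule: ord_cases)
    case (2 \<gamma>)
    then show ?thesis
      using less[of \<gamma>] ord_succ_greater[of "\<alpha> + \<gamma>"] ord_succ_greater[of \<gamma>] by simp
  next
    case 3
    then have "0 < \<beta>" by (simp add: ord_limit_def ord_gr_zero_iff)
    moreover have "\<forall>\<gamma>\<in>(+) \<alpha> ` {..<\<beta>}. \<gamma> \<le> \<alpha> + \<beta>"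
      using ord_Sup_le_iff[OF countable_image_lessThan_ord] ord_add_limit[OF 3]
      by (metis order_refl)
    ultimately show ?thesis by (metis ord_add_simps(1) imageI lessThan_iff)
  qed simp
qed

lemma ord_mult_mono:
  assumes "\<beta> \<le> \<gamma>"
  shows "\<alpha> * \<beta> \<le> \<alpha> * (\<gamma>::countable_ord)"
  using assms
proof (induction \<gamma> rule: less_induct)
  case (less \<gamma>)
  show ?case
  proof (cases \<gamma> rule: ord_cases)
    case 1
    then show ?thesis using less.prems ord_zero_le[of \<beta>] by simp
  next
    case (2 \<delta>)
    then have "\<beta> = \<gamma> \<or> \<beta> \<le> \<delta>"
      using less.prems by (auto simp: le_less less_ord_succ_iff)
    then show ?thesis
      using less.IH[of \<delta>] ord_le_add[of "\<alpha> * \<delta>" \<alpha>] 2 by (auto simp: ord_succ_greater)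
  next
    case 3
    have "\<forall>\<delta>\<in>(*) \<alpha> ` {..<\<gamma>}. \<delta> \<le> \<alpha> * \<gamma>"
      using ord_Sup_le_iff[OF countable_image_lessThan_ord] ord_mult_limit[OF 3]
      by (metis order_refl)
    then show ?thesis using less.prems by (auto simp: le_less)
  qed
qed

lemma less_ord_omegaD:
  assumes "\<eta> < ord_omega"
  shows "\<exists>n. \<eta> = ord_of_nat n"
proof -
  obtain n where "\<eta> < ord_of_nat n"
    using assms by (auto simp: ord_omega_def less_ord_Sup_iff)
  then show ?thesis
  proof (induction n)
    case 0
    then show ?case using ord_zero_le[of \<eta>] by (simp add: ord_of_nat_def)
  next
    case (Suc n)
    then show ?case by (auto simp: ord_of_nat_def less_ord_succ_iff le_less)
  qed
qed

lemma ord_of_nat_less_omega: "ord_of_nat n < ord_omega"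
proof -
  have "ord_of_nat n < ord_of_nat (Suc n)"
    by (simp add: ord_of_nat_def ord_succ_greater)
  then show ?thesis
    unfolding ord_omega_def by (subst less_ord_Sup_iff) (simp, blast)
qed

lemma ord_limit_omega: "ord_limit ord_omega"
  unfolding ord_limit_def
proof safe
  assume "ord_omega = 0"
  then show False using ord_of_nat_less_omega[of 0] by (simp add: ord_of_nat_def)
next
  fix \<beta> assume \<beta>: "ord_omega = ord_succ \<beta>"
  then obtain n where "\<beta> = ord_of_nat n"
    using less_ord_omegaD ord_succ_greater by metis
  then show False
    using \<beta> ord_of_nat_less_omega[of "Suc n"] by (simp add: ord_of_nat_def)
qed

section \<open>The ordinals \<omega>\<alpha> and 2\<alpha> as suprema\<close>

lemma less_add_omega_iff: "\<eta> < \<alpha> + ord_omega \<longleftrightarrow> (\<exists>n. \<eta> < (ord_succ ^^ n) \<alpha>)"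
proof -
  have "{..<ord_omega} = range ord_of_nat"
    using less_ord_omegaD ord_of_nat_less_omega by auto
  then have "\<alpha> + ord_omega = ord_Sup (range (\<lambda>n. (ord_succ ^^ n) \<alpha>))"
    by (simp add: ord_add_limit[OF ord_limit_omega] image_image ord_add_of_nat)
  then show ?thesis by (simp add: less_ord_Sup_iff)
qed

lemma omega_mult_less:
  assumes "\<beta> < \<alpha>"
  shows "(ord_succ ^^ n) (ord_omega * \<beta>) < ord_omega * \<alpha>"
proof -
  have "(ord_succ ^^ n) (ord_omega * \<beta>) < ord_omega * \<beta> + ord_omega"
    unfolding less_add_omega_iff by (rule exI[of _ "Suc n"]) (simp add: ord_succ_greater)
  also have "\<dots> \<le> ord_omega * \<alpha>"
    using ord_mult_mono[of "ord_succ \<beta>" \<alpha> ord_omega] assms by (simp add: ord_succ_le_iff)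
  finally show ?thesis .
qed

text \<open>With \<open>omega_mult_less\<close>, the ordinals \<omega>\<beta> + n with \<beta> <
  \<alpha> are cofinal in \<omega>\<alpha>, so rank \<ge> \<omega>\<alpha> splits into countably
  many smaller thresholds.\<close>

lemma less_omega_multD:
  assumes "\<eta> < ord_omega * \<alpha>"
  shows "\<exists>\<beta><\<alpha>. \<exists>n. \<eta> < (ord_succ ^^ n) (ord_omega * \<beta>)"
proof (cases \<alpha> rule: ord_cases)
  case 1
  then show ?thesis using assms ord_zero_le[of \<eta>] by simp
next
  case (2 \<beta>)
  then show ?thesis using assms ord_succ_greater[of \<beta>] by (auto simp: less_add_omega_iff)
next
  case 3
  then obtain \<beta> where "\<beta> < \<alpha>" "\<eta> < ord_omega * \<beta>"
    using assms by (auto simp: ord_mult_limit less_ord_Sup_iff countable_lessThan_ord)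
  then have "\<eta> < (ord_succ ^^ 0) (ord_omega * \<beta>)" by simp
  then show ?thesis using \<open>\<beta> < \<alpha>\<close> by blast
qed

lemma ord_add_two: "\<alpha> + ord_of_nat 2 = ord_succ (ord_succ \<alpha>)"
  by (simp add: ord_add_of_nat numeral_2_eq_2)

lemma two_mult_less:
  assumes "\<beta> < \<alpha>"
  shows "ord_succ (ord_of_nat 2 * \<beta>) < ord_of_nat 2 * \<alpha>"
  using ord_mult_mono[of "ord_succ \<beta>" \<alpha> "ord_of_nat 2"] assms
  by (simp add: ord_succ_le_iff ord_add_two)

lemma less_two_multD:
  assumes "\<eta> < ord_of_nat 2 * \<alpha>"
  shows "\<exists>\<beta><\<alpha>. \<eta> \<le> ord_succ (ord_of_nat 2 * \<beta>)"
proof (cases \<alpha> rule: ord_cases)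
  case 1
  then show ?thesis using assms ord_zero_le[of \<eta>] by simp
next
  case (2 \<beta>)
  then show ?thesis
    using assms ord_succ_greater[of \<beta>] by (auto simp: ord_add_two less_ord_succ_iff)
next
  case 3
  then obtain \<beta> where "\<beta> < \<alpha>" "\<eta> < ord_of_nat 2 * \<beta>"
    using assms by (auto simp: ord_mult_limit less_ord_Sup_iff countable_lessThan_ord)
  then show ?thesis by (meson less_imp_le less_ord_succ_iff order_trans)
qed

section \<open>Ranks of nodes\<close>

text \<open>Only thresholds are defined, not a rank function, so an ill-founded node needs no value
  at infinity: it passes every threshold.\<close>

inductive rank_ge :: "nat list set \<Rightarrow> countable_ord \<Rightarrow> nat list \<Rightarrow> bool" for T where
  "s \<in> T \<Longrightarrow> (\<And>\<eta>. \<eta> < \<xi> \<Longrightarrow> \<exists>n. rank_ge T \<eta> (s @ [n])) \<Longrightarrow> rank_ge T \<xi> s"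

text \<open>An infinite branch of \<open>T\<close> starts at \<open>s\<close>; in coinductive form
  it can be built one node at a time.\<close>

coinductive ill_founded :: "nat list set \<Rightarrow> nat list \<Rightarrow> bool" for T where
  "s \<in> T \<Longrightarrow> ill_founded T (s @ [n]) \<Longrightarrow> ill_founded T s"

lemma rank_ge_iff: "rank_ge T \<xi> s \<longleftrightarrow> s \<in> T \<and> (\<forall>\<eta><\<xi>. \<exists>n. rank_ge T \<eta> (s @ [n]))"
  by (subst rank_ge.simps) auto

lemma rank_ge_in: "rank_ge T \<xi> s \<Longrightarrow> s \<in> T"
  by (subst (asm) rank_ge_iff) simp

lemma rank_ge_antimono: "rank_ge T \<xi> s \<Longrightarrow> \<eta> \<le> \<xi> \<Longrightarrow> rank_ge T \<eta> s"
  by (subst (asm) rank_ge_iff, subst rank_ge_iff) auto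

lemma rank_ge_zero: "rank_ge T 0 s \<longleftrightarrow> s \<in> T"
  by (subst rank_ge_iff) simp

lemma rank_ge_succ: "rank_ge T (ord_succ \<xi>) s \<longleftrightarrow> s \<in> T \<and> (\<exists>n. rank_ge T \<xi> (s @ [n]))"
  unfolding rank_ge_iff[of T "ord_succ \<xi>" s] less_ord_succ_iff
  using rank_ge_antimono by blast

lemma ill_founded_in: "ill_founded T s \<Longrightarrow> s \<in> T"
  by (auto elim: ill_founded.cases)

lemma ill_founded_rank_ge: "ill_founded T s \<Longrightarrow> rank_ge T \<xi> s"
proof (induction \<xi> arbitrary: s rule: less_induct)
  case (less \<xi>)
  from less.prems obtain n where "s \<in> T" "ill_founded T (s @ [n])"
    by (auto elim: ill_founded.cases)
  then show ?case using less.IH by (subst rank_ge_iff) blast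
qed

text \<open>Unlike \<open>Trees\<close>, this admits the empty set, the value used in base cases of
  the constructions.\<close>

definition prefix_closed :: "nat list set \<Rightarrow> bool" where
  "prefix_closed T \<longleftrightarrow> (\<forall>s t. s @ t \<in> T \<longrightarrow> s \<in> T)"

lemma Trees_iff: "T \<in> Trees \<longleftrightarrow> [] \<in> T \<and> prefix_closed T"
  by (simp add: Trees_def prefix_closed_def)

lemma prefix_closedD: "prefix_closed T \<Longrightarrow> s @ t \<in> T \<Longrightarrow> s \<in> T"
  by (auto simp: prefix_closed_def)

text \<open>Iterates are intersected at limits, while \<open>rank_ge\<close> asks for a child at
  each smaller threshold; these agree because \<eta> < \<xi> gives \<eta> + 1 < \<xi>.\<close>

lemma rank_ge_limit:
  assumes "prefix_closed T" "ord_limit \<xi>"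
  shows "rank_ge T \<xi> s \<longleftrightarrow> (\<forall>\<eta><\<xi>. rank_ge T \<eta> s)"
proof
  assume R: "\<forall>\<eta><\<xi>. rank_ge T \<eta> s"
  have "0 < \<xi>" using assms(2) by (simp add: ord_limit_def ord_gr_zero_iff)
  then have "s \<in> T" using R by (auto dest: rank_ge_in)
  moreover have "\<exists>n. rank_ge T \<eta> (s @ [n])" if "\<eta> < \<xi>" for \<eta>
    using R ord_limit_succ_less[OF assms(2) that] by (auto simp: rank_ge_succ)
  ultimately show "rank_ge T \<xi> s" by (subst rank_ge_iff) simp
qed (auto intro: rank_ge_antimono)

text \<open>Each successor costs one generation, and prefix closure supplies the nodes in between. A
  finite increment of a threshold thus becomes a countable union over \<open>t\<close>.\<close>

lemma rank_ge_funpow_succ: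
  assumes "prefix_closed T"
  shows "rank_ge T ((ord_succ ^^ n) \<xi>) s \<longleftrightarrow> (\<exists>t. length t = n \<and> rank_ge T \<xi> (s @ t))"
proof (induction n arbitrary: s)
  case (Suc n)
  have "rank_ge T ((ord_succ ^^ Suc n) \<xi>) s \<longleftrightarrow>
      s \<in> T \<and> (\<exists>m t. length t = n \<and> rank_ge T \<xi> (s @ m # t))"
    by (simp add: rank_ge_succ Suc.IH)
  also have "\<dots> \<longleftrightarrow> (\<exists>m t. length t = n \<and> rank_ge T \<xi> (s @ m # t))"
    using prefix_closedD[OF assms] rank_ge_in by blast
  also have "\<dots> \<longleftrightarrow> (\<exists>t. length t = Suc n \<and> rank_ge T \<xi> (s @ t))"
    by (metis length_Suc_conv)
  finally show ?case .
qed simp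

lemma rank_ge_append:
  assumes "prefix_closed T" "rank_ge T \<xi> (s @ t)"
  shows "rank_ge T \<xi> s"
proof -
  have "\<xi> \<le> (ord_succ ^^ n) \<xi>" for n
    by (metis ord_add_of_nat ord_le_add)
  then show ?thesis
    using rank_ge_funpow_succ[OF assms(1), of "length t" \<xi> s] assms(2)
    by (blast intro: rank_ge_antimono)
qed

lemma rank_ge_shift: "rank_ge T \<xi> (u @ s) \<longleftrightarrow> rank_ge {t. u @ t \<in> T} \<xi> s"
proof (induction \<xi> arbitrary: s rule: less_induct)
  case (less \<xi>)
  then show ?case
    by (subst rank_ge_iff, subst (2) rank_ge_iff) simp
qed

lemma ill_founded_shift: "ill_founded T (u @ s) \<longleftrightarrow> ill_founded {t. u @ t \<in> T} s"
proof
  show "ill_founded {t. u @ t \<in> T} s" if "ill_founded T (u @ s)"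
    using that
  proof (coinduction arbitrary: s)
    case ill_founded
    then obtain n where "u @ s \<in> T" "ill_founded T ((u @ s) @ [n])"
      by (auto elim: ill_founded.cases)
    then show ?case by auto
  qed
next
  assume "ill_founded {t. u @ t \<in> T} s"
  then have "\<exists>t. u @ s = u @ t \<and> ill_founded {t. u @ t \<in> T} t" by blast
  then show "ill_founded T (u @ s)"
  proof (coinduct rule: ill_founded.coinduct)
    case (ill_founded v)
    then obtain t where t: "v = u @ t" "ill_founded {t. u @ t \<in> T} t" by blast
    from t(2) obtain n where "u @ t \<in> T" "ill_founded {t. u @ t \<in> T} (t @ [n])"
      by (auto elim: ill_founded.cases)
    then show ?case using t(1) by auto
  qed
qed

text \<open>The recursions for iterates and thresholds match clause by clause. The root is excluded
  because the derivative keeps it whatever its rank.\<close>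

lemma Lusin_iterate_rank:
  assumes "T \<in> Trees" "s \<noteq> []"
  shows "s \<in> Lusin_iterate \<xi> T \<longleftrightarrow> rank_ge T \<xi> s"
  using assms(2)
proof (induction \<xi> arbitrary: s rule: less_induct)
  case (less \<xi>)
  have T: "prefix_closed T" using assms(1) by (simp add: Trees_iff)
  show ?case
  proof (cases \<xi> rule: ord_cases)
    case 1
    then show ?thesis by (simp add: Lusin_iterate_0 rank_ge_zero)
  next
    case (2 \<eta>)
    then have "s \<in> Lusin_iterate \<xi> T \<longleftrightarrow> (\<exists>n. rank_ge T \<eta> (s @ [n]))"
      using less Lusin_iterate_succ[of \<eta> T]
      by (auto simp: ord_add_1 Lusin_derivative_def ord_succ_greater)
    also have "\<dots> \<longleftrightarrow> rank_ge T \<xi> s"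
      using prefix_closedD[OF T] rank_ge_in unfolding 2 rank_ge_succ by blast
    finally show ?thesis .
  next
    case 3
    then show ?thesis
      using less by (auto simp: Lusin_iterate_limit rank_ge_limit[OF T])
  qed
qed

text \<open>An iterate equal to its derivative never changes again, so stability may be tested at
  any \<gamma>.\<close>

lemma Lusin_height_le_iff:
  assumes "T \<in> Trees"
  shows "Lusin_height T \<le> \<gamma> \<longleftrightarrow> Lusin_iterate (\<gamma> + 1) T = Lusin_iterate \<gamma> T"
proof
  let ?h = "Lusin_height T"
  assume "?h \<le> \<gamma>"
  have "?h \<le> \<xi> \<Longrightarrow> Lusin_iterate \<xi> T = Lusin_iterate ?h T" for \<xi>
  proof (induction \<xi> rule: less_induct)
    case (less \<xi>)
    show ?case
    proof (cases "\<xi> = ?h")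
      case False
      then have less': "?h < \<xi>" using less.prems by simp
      show ?thesis
      proof (cases \<xi> rule: ord_cases)
        case 1
        then show ?thesis using less' ord_zero_le leD by blast
      next
        case (2 \<eta>)
        then have "Lusin_iterate \<eta> T = Lusin_iterate ?h T"
          using less' less.IH[of \<eta>] by (simp add: less_ord_succ_iff ord_succ_greater)
        then show ?thesis
          using Lusin_height_stable[OF assms] 2 Lusin_iterate_succ by (metis ord_add_1)
      next
        case 3
        have "Lusin_iterate ?h T \<subseteq> Lusin_iterate \<eta> T" if "\<eta> < \<xi>" for \<eta>
          using that less.IH[of \<eta>] Lusin_iterate_tree[OF assms, of ?h] by (metis linear order_refl)
        then show ?thesis using less' by (auto simp: Lusin_iterate_limit[OF 3])
      qed
    qed simp
  qed
  moreover have "?h \<le> \<gamma> + 1"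
    using \<open>?h \<le> \<gamma>\<close> ord_succ_greater[of \<gamma>] by (simp add: ord_add_1)
  ultimately show "Lusin_iterate (\<gamma> + 1) T = Lusin_iterate \<gamma> T"
    using \<open>?h \<le> \<gamma>\<close> by metis
qed (auto simp: Lusin_height_def intro: Least_le)

text \<open>The two iterates are nested and share the root, so their equality is one inclusion at
  nonempty nodes.\<close>

lemma LT_less_iff:
  "T \<in> LT_less (\<gamma> + 1) \<longleftrightarrow>
    T \<in> Trees \<and> (\<forall>s. s \<noteq> [] \<longrightarrow> rank_ge T \<gamma> s \<longrightarrow> rank_ge T (ord_succ \<gamma>) s)"
proof (cases "T \<in> Trees")
  case True
  have eq_iff: "A = B \<longleftrightarrow> (\<forall>s. s \<noteq> [] \<longrightarrow> s \<in> B \<longrightarrow> s \<in> A)"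
    if "A \<subseteq> B" "[] \<in> A" for A B :: "nat list set"
    using that by (metis subsetI subset_antisym)
  have "Lusin_iterate (\<gamma> + 1) T \<subseteq> Lusin_iterate \<gamma> T"
    "[] \<in> Lusin_iterate (\<gamma> + 1) T"
    using Lusin_iterate_tree[OF True, of "\<gamma> + 1"] ord_succ_greater[of \<gamma>]
    by (auto simp: ord_add_1 Trees_def)
  then have "Lusin_iterate (\<gamma> + 1) T = Lusin_iterate \<gamma> T \<longleftrightarrow>
      (\<forall>s. s \<noteq> [] \<longrightarrow> s \<in> Lusin_iterate \<gamma> T \<longrightarrow> s \<in> Lusin_iterate (\<gamma> + 1) T)"
    by (rule eq_iff)
  then show ?thesis
    using True Lusin_height_le_iff[OF True, of \<gamma>]
    by (simp add: LT_less_def ord_add_1 less_ord_succ_iff Lusin_iterate_rank[OF True])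
qed (simp add: LT_less_def)

section \<open>The even multiplicative Borel classes\<close>

definition clopenin :: "'a topology \<Rightarrow> 'a set \<Rightarrow> bool" where
  "clopenin X U \<longleftrightarrow> openin X U \<and> closedin X U"

lemma clopenin_empty [simp]: "clopenin X {}"
  by (simp add: clopenin_def)

lemma clopenin_Int: "clopenin X U \<Longrightarrow> clopenin X V \<Longrightarrow> clopenin X (U \<inter> V)"
  by (auto simp: clopenin_def)

lemma clopenin_INT_lessThan:
  "(\<And>i::nat. i < n \<Longrightarrow> clopenin X (U i)) \<Longrightarrow>
    clopenin X {x \<in> topspace X. \<forall>i<n. x \<in> U i}"
proof (induction n)
  case 0
  then show ?case by (simp add: clopenin_def)
next
  case (Suc n)
  then have "clopenin X ({x \<in> topspace X. \<forall>i<n. x \<in> U i} \<inter> U n)"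
    by (intro clopenin_Int) auto
  also have "{x \<in> topspace X. \<forall>i<n. x \<in> U i} \<inter> U n = {x \<in> topspace X. \<forall>i<Suc n. x \<in> U i}"
    by (auto simp: less_Suc_eq)
  finally show ?case .
qed

text \<open>\<open>even_Pi X \<alpha>\<close> stands for \<open>\<Pi>\<^sup>0\<^sub>2\<^sub>\<alpha>\<close>, with the clopen sets in the missing place \<open>\<alpha> = 0\<close>.\<close>

inductive even_Pi :: "'a topology \<Rightarrow> countable_ord \<Rightarrow> 'a set \<Rightarrow> bool" for X where
  clopen: "clopenin X U \<Longrightarrow> even_Pi X 0 U"
| step: "(\<And>n::nat. \<beta> n < \<alpha>) \<Longrightarrow> (\<And>n (m::nat). even_Pi X (\<beta> n) (C n m)) \<Longrightarrow>
    even_Pi X \<alpha> (\<Inter>n. \<Union>m. C n m)"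

lemma even_Pi_clopen:
  assumes "clopenin X U"
  shows "even_Pi X \<alpha> U"
proof (cases "\<alpha> = 0")
  case False
  then have "even_Pi X \<alpha> (\<Inter>n::nat. \<Union>m::nat. U)"
    using assms by (intro even_Pi.step[of "\<lambda>_. 0"] even_Pi.clopen) (auto simp: ord_gr_zero_iff)
  then show ?thesis by simp
qed (use assms in \<open>auto intro: even_Pi.clopen\<close>)

lemma even_Pi_INT_UN:
  assumes I: "countable I" "I \<noteq> {}" and J: "\<And>i. i \<in> I \<Longrightarrow> countable (J i)"
    and \<beta>: "\<And>i. i \<in> I \<Longrightarrow> \<beta> i < \<alpha>"
    and C: "\<And>i j. i \<in> I \<Longrightarrow> j \<in> J i \<Longrightarrow> even_Pi X (\<beta> i) (C i j)"
  shows "even_Pi X \<alpha> (\<Inter>i\<in>I. \<Union>j\<in>J i. C i j)"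
proof -
  let ?i = "from_nat_into I"
  \<comment> \<open>An empty \<open>J i\<close> is replaced by the constant empty set, which is
    clopen and hence in every class.\<close>
  let ?C = "\<lambda>n m. if J (?i n) = {} then {} else C (?i n) (from_nat_into (J (?i n)) m)"
  have i: "?i n \<in> I" for n using I by (simp add: from_nat_into)
  have "even_Pi X \<alpha> (\<Inter>n. \<Union>m. ?C n m)"
    using i by (intro even_Pi.step[of "\<lambda>n. \<beta> (?i n)"])
      (auto intro: \<beta> C from_nat_into even_Pi_clopen)
  also have "(\<Inter>n. \<Union>m. ?C n m) = (\<Inter>n. \<Union>j\<in>J (?i n). C (?i n) j)"
  proof (rule INF_cong)
    show "(\<Union>m. ?C n m) = (\<Union>j\<in>J (?i n). C (?i n) j)" for n
    proof (cases "J (?i n) = {}")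
      case False
      then have "J (?i n) = range (from_nat_into (J (?i n)))"
        using J[OF i] by (simp add: range_from_nat_into)
      then have "(\<Union>j\<in>J (?i n). C (?i n) j) = (\<Union>j\<in>range (from_nat_into (J (?i n))). C (?i n) j)"
        by simp
      then show ?thesis using False by simp
    qed simp
  qed simp
  also have "\<dots> = (\<Inter>i\<in>range ?i. \<Union>j\<in>J i. C i j)" by simp
  also have "range ?i = I" using I by (simp add: range_from_nat_into)
  finally show ?thesis .
qed

lemma even_Pi_subset: "even_Pi X \<alpha> C \<Longrightarrow> C \<subseteq> topspace X"
proof (induction rule: even_Pi.induct)
  case (clopen U)
  then show ?case by (simp add: clopenin_def openin_subset)
next
  case (step \<beta> \<alpha> C)
  have "(\<Inter>n. \<Union>m. C n m) \<subseteq> (\<Union>m. C 0 m)" by (rule INT_lower) simp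
  also have "\<dots> \<subseteq> topspace X" by (rule UN_least) (rule step.IH)
  finally show ?case .
qed

text \<open>By de Morgan the complement is a union over \<open>n\<close> of intersections over
  \<open>m\<close> of complements of \<open>C n m\<close>. By induction the latter are unions of
  sets of class \<open>\<beta> n\<close>, so each intersection has class \<alpha> again.\<close>

lemma Diff_even_Pi:
  assumes "even_Pi X \<alpha> C"
  shows "\<exists>E. topspace X - C = (\<Union>n::nat. E n) \<and> (\<forall>n. even_Pi X \<alpha> (E n))"
  using assms
proof (induction rule: even_Pi.induct)
  case (clopen U)
  then have "clopenin X (topspace X - U)" by (auto simp: clopenin_def)
  then show ?case
    by (intro exI[of _ "\<lambda>_. topspace X - U"]) (auto intro: even_Pi.clopen)
next
  case (step \<beta> \<alpha> C)
  from step.IH obtain E where E: "topspace X - C n m = (\<Union>j::nat. E n m j)"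
    "even_Pi X (\<beta> n) (E n m j)" for n m j by metis
  show ?case
  proof (intro exI conjI allI)
    show "topspace X - (\<Inter>n. \<Union>m. C n m) = (\<Union>n. \<Inter>m. \<Union>j. E n m j)"
      by (auto simp flip: E(1))
    show "even_Pi X \<alpha> (\<Inter>m. \<Union>j. E n m j)" for n
      using step.hyps(1) E(2) by (intro even_Pi.step[of "\<lambda>_. \<beta> n"]) auto
  qed
qed

section \<open>Comparison with the Borel hierarchy\<close>

lemma one_le_ord_iff: "1 \<le> \<alpha> \<longleftrightarrow> \<alpha> \<noteq> (0::countable_ord)"
  by (simp add: one_countable_ord_def ord_succ_le_iff ord_gr_zero_iff)

lemma Borel_PiI:
  assumes "Borel_Sigma X \<xi> (topspace X - A)" "A \<subseteq> topspace X"
  shows "Borel_Pi X \<xi> A"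
  using Pi_compl[OF assms(1)] assms(2) by (simp add: double_diff)

text \<open>The union of the \<open>C n m\<close> over \<open>m\<close> has additive class 2\<beta>
  + 1, where \<beta> is \<open>\<beta> n\<close>, so its complement has multiplicative class
  2\<beta> + 1 < 2\<alpha>; the union of these complements has additive class 2\<alpha>.\<close>

lemma even_Pi_imp_Borel_Pi:
  assumes "even_Pi X \<alpha> C" "\<alpha> \<noteq> 0"
  shows "Borel_Pi X (ord_of_nat 2 * \<alpha>) C"
  using assms
proof (induction rule: even_Pi.induct)
  case (step \<beta> \<alpha> C)
  let ?d = "(*) (ord_of_nat 2) :: countable_ord \<Rightarrow> countable_ord"
  have C: "C n m \<subseteq> topspace X" for n m
    using step.hyps by (blast dest: even_Pi_subset)
  have Sigma: "Borel_Sigma X (ord_succ (?d (\<beta> n))) (\<Union>m. C n m)" for n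
  proof (cases "\<beta> n = 0")
    case True
    \<comment> \<open>At level 0 the union consists of clopen sets and is open, which is additive
      class 1 = 2 * 0 + 1.\<close>
    then have "openin X (C n m)" for m
      using step.hyps(2)[of n m] by (auto elim: even_Pi.cases simp: clopenin_def)
    then have "Borel_Sigma X 1 (\<Union>m. C n m)" by (intro Sigma_open) auto
    then show ?thesis using True by (simp add: one_countable_ord_def)
  next
    case False
    then have "1 \<le> ?d (\<beta> n)"
      using two_mult_less[of 0 "\<beta> n"] by (auto simp: one_le_ord_iff ord_gr_zero_iff)
    then have "1 < ord_succ (?d (\<beta> n))" by (simp add: less_ord_succ_iff)
    then show ?thesis
      using \<open>1 \<le> ?d (\<beta> n)\<close> step.IH False
      by (intro Sigma_Union[of _ "\<lambda>_. ?d (\<beta> n)"]) (auto simp: ord_succ_greater)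
  qed
  have "Borel_Sigma X (?d \<alpha>) (\<Union>n. topspace X - (\<Union>m. C n m))"
  proof (rule Sigma_Union[where \<eta> = "\<lambda>n. ord_succ (?d (\<beta> n))"])
    show "1 \<le> ord_succ (?d (\<beta> n)) \<and> ord_succ (?d (\<beta> n)) < ?d \<alpha>" for n
      using two_mult_less[OF step.hyps(1)] ord_zero_le
      by (simp add: one_countable_ord_def ord_succ_le_iff less_ord_succ_iff)
    then show "1 < ?d \<alpha>" by (meson order_le_less_trans)
    show "Borel_Pi X (ord_succ (?d (\<beta> n))) (topspace X - (\<Union>m. C n m))" for n
      by (rule Pi_compl[OF Sigma])
  qed
  also have "(\<Union>n. topspace X - (\<Union>m. C n m)) = topspace X - (\<Inter>n. \<Union>m. C n m)" by auto
  finally show ?case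
    using C by (intro Borel_PiI) blast+
qed simp

text \<open>Zero-dimensionality gives clopen neighbourhoods inside \<open>U\<close>. Separability
  cuts them down to countably many: one choice for each ball with centre in \<open>D\<close> and
  radius 1/(n+1).\<close>

lemma open_eq_UN_clopen:
  assumes X: "Polish_space X" "zero_dimensional_space X" and U: "openin X U"
  shows "\<exists>V::nat \<Rightarrow> 'a set. U = (\<Union>n. V n) \<and> (\<forall>n. clopenin X (V n))"
proof -
  obtain M d where M: "Metric_space M d" and X_eq: "X = Metric_space.mtopology M d"
    using X(1) by (auto simp: Polish_space_def completely_metrizable_space_def)
  interpret Metric_space M d by (rule M)
  obtain D where D: "countable D" "D \<subseteq> M" "X closure_of D = M"
    using X(1) by (auto simp: Polish_space_def separable_space_def X_eq)
  let ?P = "\<lambda>q n V. clopenin X V \<and> mball q (inverse (real (Suc n))) \<subseteq> V \<and> V \<subseteq> U"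
  define W where "W q n = (if \<exists>V. ?P q n V then SOME V. ?P q n V else {})" for q and n :: nat
  have W: "clopenin X (W q n)" "W q n \<subseteq> U" for q n
    using someI_ex[of "?P q n"] by (auto simp: W_def)
  have "x \<in> (\<Union>(q, n)\<in>D \<times> UNIV. W q n)" if "x \<in> U" for x
  proof -
    obtain V where V: "openin X V" "closedin X V" "x \<in> V" "V \<subseteq> U"
      using X(2) U \<open>x \<in> U\<close> unfolding zero_dimensional_space_def by metis
    then obtain r where r: "0 < r" "mball x r \<subseteq> V"
      unfolding X_eq openin_mtopology by blast
    have "x \<in> M" using openin_subset[OF U] \<open>x \<in> U\<close> by (auto simp: X_eq)
    obtain n where n: "inverse (real (Suc n)) < r / 2"
      using reals_Archimedean[of "r / 2"] r by auto
    let ?e = "inverse (real (Suc n))"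
    have "x \<in> mtopology closure_of D" using \<open>x \<in> M\<close> D(3) by (simp add: X_eq)
    then have "\<exists>q\<in>D. q \<in> mball x ?e"
      unfolding metric_closure_of by simp
    then obtain q where q: "q \<in> D" "q \<in> mball x ?e" by blast
    have "mball q ?e \<subseteq> mball x r"
    proof
      fix y assume y: "y \<in> mball q ?e"
      then have "d x y \<le> d x q + d q y" using q y \<open>x \<in> M\<close> by (intro triangle) auto
      also have "\<dots> < r" using q y n by auto
      finally show "y \<in> mball x r" using q y by auto
    qed
    then have "?P q n V" using V r by (auto simp: clopenin_def)
    then have "\<exists>V. ?P q n V" by blast
    then have "?P q n (W q n)" unfolding W_def if_P[OF \<open>\<exists>V. ?P q n V\<close>] by (rule someI_ex)
    then have "x \<in> W q n" using q \<open>x \<in> M\<close> by (auto simp: commute)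
    then show ?thesis using q(1) by blast
  qed
  then have U_eq: "U = (\<Union>(q, n)\<in>D \<times> UNIV. W q n)" using W(2) by fast
  show ?thesis
  proof (cases "D = {}")
    case True
    then show ?thesis using U_eq by (intro exI[of _ "\<lambda>_. {}"]) simp
  next
    case False
    let ?f = "from_nat_into (D \<times> (UNIV :: nat set))"
    have "range ?f = D \<times> UNIV" using D(1) False by (intro range_from_nat_into) auto
    then have "U = (\<Union>n. case ?f n of (q, m) \<Rightarrow> W q m)"
      using U_eq by (metis image_image)
    then show ?thesis
      using W(1) by (intro exI[of _ "\<lambda>n. case ?f n of (q, m) \<Rightarrow> W q m"])
        (auto split: prod.splits)
  qed
qed

lemma Borel_Pi_cases:
  assumes "Borel_Pi X \<xi> A"
  obtains S where "A = topspace X - S" "Borel_Sigma X \<xi> S"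
  using assms by cases (rule that)

lemma Borel_subset:
  shows "Borel_Sigma X \<xi> A \<Longrightarrow> A \<subseteq> topspace X"
    and "Borel_Pi X \<xi> A \<Longrightarrow> A \<subseteq> topspace X"
proof (induction rule: Borel_Sigma_Borel_Pi.inducts)
  case (Sigma_open U)
  then show ?case by (rule openin_subset)
qed blast+

text \<open>Each half uses the other at smaller \<xi>, hence the joint induction. Bounds on \<xi> in
  place of equalities let every class be rounded up to the form 2\<beta> + 1 or 2\<alpha>.\<close>

lemma Borel_imp_even_Pi:
  assumes X: "Polish_space X" "zero_dimensional_space X"
  shows "(\<forall>\<beta> S. \<xi> \<le> ord_succ (ord_of_nat 2 * \<beta>) \<longrightarrow> Borel_Sigma X \<xi> S \<longrightarrow>
        (\<exists>C. S = (\<Union>m::nat. C m) \<and> (\<forall>m. even_Pi X \<beta> (C m)))) \<and>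
    (\<forall>\<alpha> A. \<alpha> \<noteq> 0 \<longrightarrow> \<xi> \<le> ord_of_nat 2 * \<alpha> \<longrightarrow> Borel_Pi X \<xi> A \<longrightarrow> even_Pi X \<alpha> A)"
proof (induction \<xi> rule: less_induct)
  case (less \<xi>)
  let ?d = "(*) (ord_of_nat 2) :: countable_ord \<Rightarrow> countable_ord"
  have openD: "\<exists>C. S = (\<Union>m::nat. C m) \<and> (\<forall>m. even_Pi X \<beta> (C m))" if "openin X S" for S \<beta>
    using open_eq_UN_clopen[OF X that] by (metis even_Pi_clopen)
  have Sigma: "\<exists>C. S = (\<Union>m::nat. C m) \<and> (\<forall>m. even_Pi X \<beta> (C m))"
    if "\<xi> \<le> ord_succ (?d \<beta>)" "Borel_Sigma X \<xi> S" for \<beta> S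
    using that(2)
  proof cases
    case Sigma_open
    then show ?thesis using openD by blast
  next
    case (Sigma_Union \<eta> A)
    then have \<eta>: "\<eta> n \<le> ?d \<beta>" for n
      using that(1) by (meson less_ord_succ_iff order_less_le_trans)
    then have "\<beta> \<noteq> 0"
      using Sigma_Union(3)[of 0] \<eta>[of 0] by (auto simp: one_le_ord_iff)
    then have "even_Pi X \<beta> (A n)" for n
      using less.IH[of "\<eta> n"] Sigma_Union(3,4)[of n] \<eta>[of n] by simp
    then show ?thesis using Sigma_Union(1) by blast
  qed
  have "even_Pi X \<alpha> A" if \<alpha>: "\<alpha> \<noteq> 0" "\<xi> \<le> ?d \<alpha>" and A: "Borel_Pi X \<xi> A" for \<alpha> A
  proof -
    obtain S where S: "A = topspace X - S" "Borel_Sigma X \<xi> S"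
      using A by (rule Borel_Pi_cases)
    show ?thesis
      using S(2)
    proof cases
      case Sigma_open
      \<comment> \<open>A closed set is an intersection of complements of clopen sets, each a union
        of sets of level 0 < \<alpha>.\<close>
      have "0 < \<alpha>" using \<open>\<alpha> \<noteq> 0\<close> by (simp add: ord_gr_zero_iff)
      obtain C where C: "S = (\<Union>m::nat. C m)" "\<And>m. even_Pi X 0 (C m)"
        using openD[OF Sigma_open(2), of 0] by blast
      then have "\<exists>E. topspace X - C m = (\<Union>n::nat. E n) \<and> (\<forall>n. even_Pi X 0 (E n))" for m
        by (intro Diff_even_Pi)
      then obtain E where E: "topspace X - C m = (\<Union>n::nat. E m n)" "even_Pi X 0 (E m n)" for m n
        by metis
      have "A = (\<Inter>m. \<Union>n. E m n)" using S(1) C(1) by (simp flip: E(1))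
      moreover have "even_Pi X \<alpha> (\<Inter>m. \<Union>n. E m n)"
        using \<open>0 < \<alpha>\<close> E(2) by (intro even_Pi.step[of "\<lambda>_. 0"])
      ultimately show ?thesis by simp
    next
      case (Sigma_Union \<eta> B)
      have "\<exists>S'. B n = topspace X - S' \<and> Borel_Sigma X (\<eta> n) S'" for n
        using Sigma_Union(4)[of n] by (rule Borel_Pi_cases) blast
      then obtain R where R: "B n = topspace X - R n" "Borel_Sigma X (\<eta> n) (R n)" for n by metis
      have "\<exists>\<beta><\<alpha>. \<eta> n \<le> ord_succ (?d \<beta>)" for n
        using Sigma_Union(3)[of n] \<alpha>(2) by (intro less_two_multD) auto
      then obtain \<beta> where \<beta>: "\<beta> n < \<alpha>" "\<eta> n \<le> ord_succ (?d (\<beta> n))" for n by metis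
      have "\<exists>C. R n = (\<Union>m::nat. C m) \<and> (\<forall>m. even_Pi X (\<beta> n) (C m))" for n
        using less.IH[of "\<eta> n"] Sigma_Union(3)[of n] R(2)[of n] \<beta>(2)[of n] by simp
      then obtain C where C: "R n = (\<Union>m::nat. C n m)" "even_Pi X (\<beta> n) (C n m)" for n m
        by metis
      have "A = (\<Inter>n. R n)"
        unfolding S(1) Sigma_Union(1) R(1) using Borel_subset(1)[OF R(2)] by blast
      then have "A = (\<Inter>n. \<Union>m. C n m)" unfolding C(1) .
      then show ?thesis using even_Pi.step[OF \<beta>(1) C(2)] by simp
    qed
  qed
  with Sigma show ?case by blast
qed

lemma Borel_Pi_iff_even_Pi:
  assumes "Polish_space X" "zero_dimensional_space X" "\<alpha> \<noteq> 0"
  shows "Borel_Pi X (ord_of_nat 2 * \<alpha>) A \<longleftrightarrow> even_Pi X \<alpha> A"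
proof
  show "even_Pi X \<alpha> A" if "Borel_Pi X (ord_of_nat 2 * \<alpha>) A"
    using Borel_imp_even_Pi[OF assms(1,2), of "ord_of_nat 2 * \<alpha>"] that assms(3) by simp
qed (use assms(3) in \<open>auto intro: even_Pi_imp_Borel_Pi\<close>)

lemma even_Pi_succD:
  assumes "even_Pi X (ord_succ \<alpha>) A"
  shows "\<exists>\<beta> C. A = (\<Inter>n::nat. \<Union>m::nat. C n m) \<and> (\<forall>n. \<beta> n \<le> \<alpha> \<and> (\<forall>m. even_Pi X (\<beta> n) (C n m)))"
  using assms
proof cases
  case clopen
  then show ?thesis using ord_succ_greater[of \<alpha>] by simp
next
  case (step \<beta> C)
  then show ?thesis by (metis less_ord_succ_iff)
qed

section \<open>The complexity of the sets of trees of bounded height\<close>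

lemma clopenin_tree_topology: "clopenin tree_topology {T \<in> Trees. s \<in> T}"
proof -
  have "continuous_map tree_topology (discrete_topology UNIV) ((\<lambda>h. h s) \<circ> (\<lambda>T s. s \<in> T))"
    unfolding tree_topology_def
    by (intro continuous_map_pullback continuous_map_product_projection) simp
  then have c: "continuous_map tree_topology (discrete_topology UNIV) (\<lambda>T. s \<in> T)"
    by (simp add: comp_def)
  have "openin tree_topology {T \<in> topspace tree_topology. (s \<in> T) \<in> {True}}"
    by (rule openin_continuous_map_preimage[OF c]) simp
  moreover have "closedin tree_topology {T \<in> topspace tree_topology. (s \<in> T) \<in> {True}}"
    by (rule closedin_continuous_map_preimage[OF c]) simp
  ultimately show ?thesis by (simp add: clopenin_def topspace_tree_topology)
qed

text \<open>Cofinality of the \<omega>\<beta> + n, with finite increments traded for generations,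
  brings the condition into the intersection-of-unions form of \<open>even_Pi\<close>.\<close>

lemma rank_ge_omega_mult_iff:
  assumes "prefix_closed T" "\<alpha> \<noteq> 0"
  shows "rank_ge T (ord_omega * \<alpha>) s \<longleftrightarrow>
    (\<forall>\<beta><\<alpha>. \<forall>n. \<exists>t. length t = n \<and> rank_ge T (ord_omega * \<beta>) (s @ t))"
proof -
  have "rank_ge T (ord_omega * \<alpha>) s \<longleftrightarrow>
      (\<forall>\<beta><\<alpha>. \<forall>n. rank_ge T ((ord_succ ^^ n) (ord_omega * \<beta>)) s)" (is "_ \<longleftrightarrow> ?R")
  proof
    show ?R if "rank_ge T (ord_omega * \<alpha>) s"
      using that omega_mult_less by (blast intro: rank_ge_antimono less_imp_le)
  next
    assume R: ?R
    \<comment> \<open>The instance \<beta> = 0, n = 0, available since \<alpha> \<noteq> 0, shows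
      that \<open>s\<close> is a node.\<close>
    have "rank_ge T ((ord_succ ^^ 0) (ord_omega * 0)) s"
      using R assms(2) ord_gr_zero_iff by blast
    then have "s \<in> T" by (rule rank_ge_in)
    moreover have "\<exists>n. rank_ge T \<eta> (s @ [n])" if "\<eta> < ord_omega * \<alpha>" for \<eta>
    proof -
      obtain \<beta> n where "\<beta> < \<alpha>" "\<eta> < (ord_succ ^^ n) (ord_omega * \<beta>)"
        using less_omega_multD[OF \<open>\<eta> < ord_omega * \<alpha>\<close>] by blast
      then show ?thesis
        using R rank_ge_iff[of T "(ord_succ ^^ n) (ord_omega * \<beta>)" s] by blast
    qed
    ultimately show "rank_ge T (ord_omega * \<alpha>) s" by (subst rank_ge_iff) blast
  qed
  then show ?thesis by (simp add: rank_ge_funpow_succ[OF assms(1)])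
qed

lemma even_Pi_rank_ge: "even_Pi tree_topology \<alpha> {T \<in> Trees. rank_ge T (ord_omega * \<alpha>) s}"
proof (induction \<alpha> arbitrary: s rule: less_induct)
  case (less \<alpha>)
  show ?case
  proof (cases "\<alpha> = 0")
    case True
    then show ?thesis
      by (auto simp: rank_ge_zero intro: even_Pi.clopen clopenin_tree_topology)
  next
    case False
    let ?I = "{..<\<alpha>} \<times> (UNIV :: nat set)"
    let ?B = "\<lambda>i t. {T \<in> Trees. rank_ge T (ord_omega * fst i) (s @ t)}"
    have "0 < \<alpha>" using False by (simp add: ord_gr_zero_iff)
    have "even_Pi tree_topology \<alpha> (\<Inter>i\<in>?I. \<Union>t\<in>{t. length t = snd i}. ?B i t)"
      using \<open>0 < \<alpha>\<close> by (intro even_Pi_INT_UN[where \<beta> = fst] less.IH)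
        (auto simp: countable_lessThan_ord)
    also have "(\<Inter>i\<in>?I. \<Union>t\<in>{t. length t = snd i}. ?B i t) =
        {T \<in> Trees. rank_ge T (ord_omega * \<alpha>) s}"
    proof (rule set_eqI)
      fix T
      have "T \<in> (\<Inter>i\<in>?I. \<Union>t\<in>{t. length t = snd i}. ?B i t) \<longleftrightarrow>
          (\<forall>\<beta><\<alpha>. \<forall>n. \<exists>t. length t = n \<and> T \<in> Trees \<and> rank_ge T (ord_omega * \<beta>) (s @ t))"
        by auto
      also have "\<dots> \<longleftrightarrow> T \<in> Trees \<and>
          (\<forall>\<beta><\<alpha>. \<forall>n. \<exists>t. length t = n \<and> rank_ge T (ord_omega * \<beta>) (s @ t))"
        using \<open>0 < \<alpha>\<close> by blast
      also have "\<dots> \<longleftrightarrow> T \<in> Trees \<and> rank_ge T (ord_omega * \<alpha>) s"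
        using rank_ge_omega_mult_iff[OF _ False] Trees_iff by blast
      finally show "T \<in> (\<Inter>i\<in>?I. \<Union>t\<in>{t. length t = snd i}. ?B i t) \<longleftrightarrow>
          T \<in> {T \<in> Trees. rank_ge T (ord_omega * \<alpha>) s}" by simp
    qed
    finally show ?thesis .
  qed
qed

text \<open>The premise that some descendant k levels below \<open>s\<close> has rank \<ge>
  \<omega>\<alpha> becomes an intersection over that descendant, and the complement of a set
  \<open>R u\<close> is again a union of class \<alpha> sets.\<close>

lemma even_Pi_LT_less:
  "even_Pi tree_topology (ord_succ \<alpha>) (LT_less (ord_omega * \<alpha> + ord_of_nat k + 1))"
proof -
  define R where "R u = {T \<in> Trees. rank_ge T (ord_omega * \<alpha>) u}" for u
  have R: "even_Pi tree_topology \<alpha> (R u)" for u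
    unfolding R_def by (rule even_Pi_rank_ge)
  have "\<exists>E. topspace tree_topology - R u = (\<Union>n::nat. E n) \<and>
      (\<forall>n. even_Pi tree_topology \<alpha> (E n))" for u
    by (rule Diff_even_Pi[OF R])
  then obtain E where E: "topspace tree_topology - R u = (\<Union>n::nat. E u n)"
    "even_Pi tree_topology \<alpha> (E u n)" for u n
    by metis
  let ?I = "{(s, t). s \<noteq> [] \<and> length t = k} :: (nat list \<times> nat list) set"
  \<comment> \<open>\<open>Inl\<close> indexes the pieces of the complement of
    \<open>R (s @ t)\<close>, \<open>Inr\<close> the descendants k + 1 levels below
    \<open>s\<close>.\<close>
  let ?J = "UNIV <+> {t. length t = Suc k} :: (nat + nat list) set"
  let ?C = "\<lambda>(s, t) j. case j of Inl n \<Rightarrow> E (s @ t) n | Inr t' \<Rightarrow> R (s @ t')"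
  have "even_Pi tree_topology (ord_succ \<alpha>) (\<Inter>i\<in>?I. \<Union>j\<in>?J. ?C i j)"
  proof (rule even_Pi_INT_UN[where \<beta> = "\<lambda>_. \<alpha>"])
    have "([0], replicate k 0) \<in> ?I" by simp
    then show "?I \<noteq> {}" by blast
    show "even_Pi tree_topology \<alpha> (?C i j)" for i j
      using R E(2) by (auto split: prod.split sum.split)
  qed (auto simp: ord_succ_greater)
  also have "(\<Inter>i\<in>?I. \<Union>j\<in>?J. ?C i j) = LT_less (ord_omega * \<alpha> + ord_of_nat k + 1)"
  proof (rule set_eqI)
    fix T
    have inner: "T \<in> (\<Union>j\<in>?J. ?C (s, t) j) \<longleftrightarrow> T \<in> Trees \<and>
        (rank_ge T (ord_omega * \<alpha>) (s @ t) \<longrightarrow>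
          (\<exists>t'. length t' = Suc k \<and> rank_ge T (ord_omega * \<alpha>) (s @ t')))" for s t
    proof -
      have "T \<in> (\<Union>j\<in>?J. ?C (s, t) j) \<longleftrightarrow>
          T \<in> (\<Union>n. E (s @ t) n) \<or> (\<exists>t'. length t' = Suc k \<and> T \<in> R (s @ t'))"
        by (auto simp: Plus_def)
      then show ?thesis
        by (auto simp: R_def topspace_tree_topology simp flip: E(1))
    qed
    have "T \<in> (\<Inter>i\<in>?I. \<Union>j\<in>?J. ?C i j) \<longleftrightarrow>
        (\<forall>s t. s \<noteq> [] \<and> length t = k \<longrightarrow> T \<in> (\<Union>j\<in>?J. ?C (s, t) j))"
      by blast
    \<comment> \<open>Sequences of length k exist (\<open>length_replicate\<close>), so some
      instance is present and yields \<open>T \<in> Trees\<close>.\<close>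
    also have "\<dots> \<longleftrightarrow> T \<in> Trees \<and> (\<forall>s. s \<noteq> [] \<longrightarrow>
        (\<exists>t. length t = k \<and> rank_ge T (ord_omega * \<alpha>) (s @ t)) \<longrightarrow>
        (\<exists>t. length t = Suc k \<and> rank_ge T (ord_omega * \<alpha>) (s @ t)))"
      unfolding inner by (metis length_replicate list.distinct(1))
    also have "\<dots> \<longleftrightarrow> T \<in> LT_less ((ord_succ ^^ k) (ord_omega * \<alpha>) + 1)"
      unfolding LT_less_iff using rank_ge_funpow_succ[of T k] rank_ge_funpow_succ[of T "Suc k"]
      by (auto simp: Trees_iff)
    finally show "T \<in> (\<Inter>i\<in>?I. \<Union>j\<in>?J. ?C i j) \<longleftrightarrow>
        T \<in> LT_less (ord_omega * \<alpha> + ord_of_nat k + 1)"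
      by (simp add: ord_add_of_nat)
  qed
  finally show ?thesis .
qed

section \<open>Operations on trees\<close>

definition graft :: "(nat \<Rightarrow> nat list set) \<Rightarrow> nat list set" where
  "graft F = insert [] {m # t | m t. t \<in> F m}"

lemma graft_simps [simp]: "[] \<in> graft F" "m # t \<in> graft F \<longleftrightarrow> t \<in> F m"
  by (auto simp: graft_def)

lemma prefix_closed_graft: "(\<And>m. prefix_closed (F m)) \<Longrightarrow> prefix_closed (graft F)"
  unfolding prefix_closed_def
proof (intro allI impI)
  fix s t assume F: "\<And>m. \<forall>s t. s @ t \<in> F m \<longrightarrow> s \<in> F m" and st: "s @ t \<in> graft F"
  show "s \<in> graft F"
  proof (cases s)
    case (Cons m u)
    then show ?thesis using F st by auto
  qed simp
qed

lemma rank_ge_graft_Cons [simp]: "rank_ge (graft F) \<xi> (m # t) \<longleftrightarrow> rank_ge (F m) \<xi> t"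
  using rank_ge_shift[of "graft F" \<xi> "[m]" t] by simp

lemma ill_founded_graft_Cons [simp]: "ill_founded (graft F) (m # t) \<longleftrightarrow> ill_founded (F m) t"
  using ill_founded_shift[of "graft F" "[m]" t] by simp

lemma rank_ge_graft_Nil: "rank_ge (graft F) \<xi> [] \<longleftrightarrow> (\<forall>\<eta><\<xi>. \<exists>m. rank_ge (F m) \<eta> [])"
  by (subst rank_ge_iff) simp

lemma ill_founded_graft_Nil: "ill_founded (graft F) [] \<longleftrightarrow> (\<exists>m. ill_founded (F m) [])"
  by (subst ill_founded.simps) simp

lemma clopenin_graft:
  assumes "\<And>m s. clopenin X {x \<in> topspace X. s \<in> F x m}"
  shows "clopenin X {x \<in> topspace X. s \<in> graft (F x)}"
proof (cases s)
  case Nil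
  then show ?thesis by (simp add: clopenin_def)
qed (use assms in simp)

section \<open>Countable products of trees\<close>

definition coord :: "nat \<Rightarrow> nat \<Rightarrow> nat" where
  "coord i a = (let v = from_nat a :: nat list in if i < length v then v ! i else 0)"

text \<open>Numbers are decoded as finite lists padded by 0, so that one entry of a node can
  prescribe moves in finitely many rows at once.\<close>

lemma coord_surj: "\<exists>a. \<forall>i\<le>n. coord i a = v i"
  by (rule exI[of _ "to_nat (map v [0..<Suc n])"]) (simp add: coord_def del: upt_Suc)

text \<open>Row \<open>i\<close> starts late so that a node has only finitely many nonempty rows;
  membership in the product is then a finite condition.\<close>

definition row :: "nat \<Rightarrow> nat list \<Rightarrow> nat list" where
  "row i s = map (coord i) (drop i s)"

lemma row_eq_Nil [simp]: "length s \<le> i \<Longrightarrow> row i s = []"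
  by (simp add: row_def)

lemma row_append: "row i (s @ t) = row i s @ map (coord i) (drop (i - length s) t)"
  by (simp add: row_def)

text \<open>The entry \<open>s ! j\<close> of a node codes the next entries of the rows \<open>0, \<dots>, j\<close>, so that the \<open>i\<close>-th
  factor is entered at level \<open>i\<close>.\<close>

definition prod_tree :: "(nat \<Rightarrow> nat list set) \<Rightarrow> nat list set" where
  "prod_tree S = {s. \<forall>i. row i s \<in> S i}"

lemma prefix_closed_prod_tree:
  "(\<And>i. prefix_closed (S i)) \<Longrightarrow> prefix_closed (prod_tree S)"
  unfolding prefix_closed_def prod_tree_def by (auto simp: row_append)

text \<open>Every child of \<open>s\<close> extends row \<open>i\<close> by one entry, so thresholds
  pass to the factor. For \<open>i > length s\<close> the row would still be empty at the
  child.\<close>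

lemma rank_ge_prod_treeD:
  "rank_ge (prod_tree S) \<xi> s \<Longrightarrow> i \<le> length s \<Longrightarrow> rank_ge (S i) \<xi> (row i s)"
proof (induction \<xi> arbitrary: s rule: less_induct)
  case (less \<xi>)
  have "row i s \<in> S i" using rank_ge_in[OF less.prems(1)] by (simp add: prod_tree_def)
  moreover have "\<exists>n. rank_ge (S i) \<eta> (row i s @ [n])" if \<eta>: "\<eta> < \<xi>" for \<eta>
  proof -
    obtain n where "rank_ge (prod_tree S) \<eta> (s @ [n])"
      using less.prems(1) \<eta> rank_ge_iff[of "prod_tree S" \<xi> s] by blast
    then have "rank_ge (S i) \<eta> (row i (s @ [n]))"
      using less.IH[OF \<eta>] less.prems(2) by simp
    then show ?thesis using less.prems(2) by (auto simp: row_append)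
  qed
  ultimately show ?case by (subst rank_ge_iff) blast
qed

text \<open>The next entries of the rows \<open>i \<le> length s\<close> are packed into one number;
  all later rows stay empty.\<close>

lemma ill_founded_prod_tree:
  assumes "\<And>i. ill_founded (S i) (row i s)"
  shows "ill_founded (prod_tree S) s"
proof -
  have "\<forall>i. ill_founded (S i) (row i s)" using assms by blast
  then show ?thesis
  proof (coinduct rule: ill_founded.coinduct)
    case (ill_founded s)
    then have "\<forall>i. \<exists>v. ill_founded (S i) (row i s @ [v])"
      by (meson ill_founded.cases)
    then obtain v where v: "ill_founded (S i) (row i s @ [v i])" for i by metis
    obtain a where a: "\<forall>i\<le>length s. coord i a = v i" using coord_surj by blast
    have "ill_founded (S i) (row i (s @ [a]))" for i
    proof (cases "i \<le> length s")
      case True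
      then show ?thesis using v[of i] a by (simp add: row_append)
    next
      case False
      then show ?thesis using ill_founded[rule_format, of i] by simp
    qed
    moreover have "s \<in> prod_tree S"
      using ill_founded by (auto simp: prod_tree_def intro: ill_founded_in)
    ultimately show ?case by blast
  qed
qed

lemma clopenin_prod_tree:
  assumes "\<And>x i. [] \<in> S x i" "\<And>i s. clopenin X {x \<in> topspace X. s \<in> S x i}"
  shows "clopenin X {x \<in> topspace X. s \<in> prod_tree (S x)}"
proof -
  \<comment> \<open>Rows from \<open>length s\<close> on are empty and \<open>[]\<close> lies in
    every factor, so finitely many conditions remain.\<close>
  have "(\<forall>i. row i s \<in> S x i) \<longleftrightarrow> (\<forall>i<length s. row i s \<in> S x i)" for x
    using assms(1) by (metis not_less row_eq_Nil)
  then have "{x \<in> topspace X. s \<in> prod_tree (S x)} =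
      {x \<in> topspace X. \<forall>i<length s. x \<in> {x \<in> topspace X. row i s \<in> S x i}}"
    by (auto simp: prod_tree_def)
  then show ?thesis
    using clopenin_INT_lessThan[of "length s" X "\<lambda>i. {x \<in> topspace X. row i s \<in> S x i}"] assms(2)
    by simp
qed

text \<open>The roots of the \<open>G j\<close> have ranks cofinal below \<xi>, so the graft of
  \<open>G\<close> has rank exactly \<xi>. The family for \<xi> enumerates the grafts obtained for
  all \<eta> < \<xi>. A family is kept so that it can be hung beside other trees under one
  node.\<close>

lemma exists_trees_of_rank:
  "\<exists>G. (\<forall>j::nat. prefix_closed (G j) \<and> \<not> rank_ge (G j) \<xi> []) \<and> (\<forall>\<eta><\<xi>. \<exists>j. rank_ge (G j) \<eta> [])"
proof (induction \<xi> rule: less_induct)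
  case (less \<xi>)
  let ?P = "\<lambda>G \<eta>. (\<forall>j::nat. prefix_closed (G j) \<and> \<not> rank_ge (G j) \<eta> []) \<and>
    (\<forall>\<zeta><\<eta>. \<exists>j. rank_ge (G j) \<zeta> [])"
  have "\<forall>\<eta>\<in>{..<\<xi>}. \<exists>G. ?P G \<eta>" using less by simp
  from bchoice[OF this] obtain G where P: "\<forall>\<eta>\<in>{..<\<xi>}. ?P (G \<eta>) \<eta>" by blast
  have G: "prefix_closed (G \<eta> j)" "\<not> rank_ge (G \<eta> j) \<eta> []"
    "\<zeta> < \<eta> \<Longrightarrow> \<exists>j. rank_ge (G \<eta> j) \<zeta> []" if "\<eta> < \<xi>" for \<eta> \<zeta> j
    using P that by simp_all
  show ?case
  proof (cases "\<xi> = 0")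
    case True
    then show ?thesis
      by (intro exI[of _ "\<lambda>_. {}"]) (simp add: prefix_closed_def rank_ge_zero)
  next
    case False
    then have ne: "{..<\<xi>} \<noteq> {}" using ord_gr_zero_iff by blast
    let ?f = "from_nat_into {..<\<xi>}"
    have f: "?f j < \<xi>" for j using from_nat_into[OF ne] by auto
    have "\<not> rank_ge (graft (G \<eta>)) \<xi> []" if "\<eta> < \<xi>" for \<eta>
      using that G(2) by (auto simp: rank_ge_graft_Nil)
    moreover have "\<exists>j. rank_ge (graft (G (?f j))) \<eta> []" if \<eta>: "\<eta> < \<xi>" for \<eta>
    proof -
      obtain j where "?f j = \<eta>"
        using from_nat_into_surj[OF countable_lessThan_ord, of \<eta> \<xi>] \<eta> by auto
      moreover have "rank_ge (graft (G \<eta>)) \<eta> []"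
        using G(3)[OF \<eta>] by (simp add: rank_ge_graft_Nil)
      ultimately show ?thesis by blast
    qed
    ultimately show ?thesis
      using f G(1) by (intro exI[of _ "\<lambda>j. graft (G (?f j))"]) (simp add: prefix_closed_graft)
  qed
qed

section \<open>Reductions\<close>

text \<open>Every node is included, not just the root, because the height depends on all nonempty
  nodes.\<close>

definition dichotomous :: "countable_ord \<Rightarrow> nat list set \<Rightarrow> bool" where
  "dichotomous \<xi> T \<longleftrightarrow> prefix_closed T \<and> (\<forall>s. rank_ge T \<xi> s \<longrightarrow> ill_founded T s)"

lemma even_Pi_reduction:
  assumes "even_Pi X \<alpha> C"
  shows "\<exists>T. (\<forall>s. clopenin X {x \<in> topspace X. s \<in> T x}) \<and>
    (\<forall>x. dichotomous (ord_omega * \<alpha>) (T x) \<and> (x \<in> C \<longleftrightarrow> ill_founded (T x) []))"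
  using assms
proof (induction rule: even_Pi.induct)
  case (clopen U)
  \<comment> \<open>At the threshold \<omega> * 0 = 0 every node must be ill-founded: true in the
    full tree, vacuous in the empty one.\<close>
  have "ill_founded UNIV s" for s
    by (coinduction arbitrary: s) auto
  moreover have "\<not> ill_founded {} s" "\<not> rank_ge {} \<xi> s" for s \<xi>
    using ill_founded_in rank_ge_in by blast+
  moreover have "{x \<in> topspace X. s \<in> (if x \<in> U then UNIV else {})} = U" for s :: "nat list"
    using clopen openin_subset[of X U] by (auto simp: clopenin_def split: if_splits)
  ultimately show ?case
    using clopen
    by (intro exI[of _ "\<lambda>x. if x \<in> U then UNIV else {}"])
      (simp only: dichotomous_def prefix_closed_def, simp)
next
  case (step \<beta> \<alpha> C)
  then obtain T where T: "clopenin X {x \<in> topspace X. s \<in> T n m x}"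
    "dichotomous (ord_omega * \<beta> n) (T n m x)" "x \<in> C n m \<longleftrightarrow> ill_founded (T n m x) []"
    for n m s x
    by metis
  \<comment> \<open>A first move \<open>m\<close> turns the union over \<open>m\<close> into one
    factor, ill-founded at its root iff some \<open>T i m x\<close> is.\<close>
  define S where "S x i = graft (\<lambda>m. T i m x)" for x i
  have pre: "prefix_closed (S x i)" for x i
    using T(2) by (auto simp: S_def dichotomous_def intro: prefix_closed_graft)
  then have pre': "prefix_closed (prod_tree (S x))" for x
    by (rule prefix_closed_prod_tree)
  have le: "rank_ge R (ord_omega * \<beta> n) s" if "rank_ge R (ord_omega * \<alpha>) s" for R s n
    using that omega_mult_less[OF step.hyps(1), of 0 n] by (auto intro: rank_ge_antimono)
  have S_ill: "ill_founded (S x i) []" if "x \<in> (\<Inter>n. \<Union>m. C n m)" for x i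
    using that T(3) by (auto simp: S_def ill_founded_graft_Nil)
  \<comment> \<open>The root of \<open>S x i\<close> is left out: well-founded trees with ranks
    cofinal in \<omega>\<beta>, for \<beta> = \<open>\<beta> i\<close>, may lift it to rank
    \<omega>\<beta>.\<close>
  have S_dich: "ill_founded (S x i) (m # t)" if "rank_ge (S x i) (ord_omega * \<beta> i) (m # t)" for x i m t
    using that T(2) by (simp add: S_def dichotomous_def)
  have in_C: "x \<in> (\<Inter>n. \<Union>m. C n m)" if rk: "rank_ge (prod_tree (S x)) (ord_omega * \<alpha>) []" for x
  proof
    fix n
    \<comment> \<open>\<open>Suc n\<close> is the level at which row \<open>n\<close> receives its
      first entry, the choice of \<open>m\<close>.\<close>
    have "rank_ge (prod_tree (S x)) ((ord_succ ^^ Suc n) (ord_omega * \<beta> n)) []"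
      using rk omega_mult_less[OF step.hyps(1), of "Suc n" n] rank_ge_antimono less_imp_le by blast
    then obtain s where s: "length s = Suc n" "rank_ge (prod_tree (S x)) (ord_omega * \<beta> n) s"
      unfolding rank_ge_funpow_succ[OF pre'] by auto
    then have "rank_ge (S x n) (ord_omega * \<beta> n) (row n s)"
      by (intro rank_ge_prod_treeD) auto
    moreover have "length (row n s) = 1" using s(1) by (simp add: row_def)
    then obtain m where "row n s = [m]" by (auto simp: length_Suc_conv)
    ultimately have "ill_founded (T n m x) []"
      using S_dich[of x n m "[]"] by (simp add: S_def)
    then show "x \<in> (\<Union>m. C n m)" using T(3) by blast
  qed
  have "clopenin X {x \<in> topspace X. s \<in> prod_tree (S x)}" for s
    unfolding S_def by (intro clopenin_prod_tree clopenin_graft T(1)) simp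
  moreover have "dichotomous (ord_omega * \<alpha>) (prod_tree (S x))" for x
    unfolding dichotomous_def
  proof (intro conjI allI impI)
    fix s assume rk: "rank_ge (prod_tree (S x)) (ord_omega * \<alpha>) s"
    then have x: "x \<in> (\<Inter>n. \<Union>m. C n m)"
      using in_C rank_ge_append[OF pre', of x "ord_omega * \<alpha>" "[]" s] by simp
    show "ill_founded (prod_tree (S x)) s"
    proof (rule ill_founded_prod_tree)
      fix i
      \<comment> \<open>A row that is still empty needs \<open>x\<close> in the intersection; a
        nonempty one is settled by dichotomy in its factor.\<close>
      show "ill_founded (S x i) (row i s)"
      proof (cases "row i s")
        case Nil
        then show ?thesis using S_ill[OF x] by simp
      next
        case (Cons m t)
        then have "i \<le> length s" by (metis list.distinct(1) nat_le_linear row_eq_Nil)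
        then have "rank_ge (S x i) (ord_omega * \<beta> i) (m # t)"
          using rank_ge_prod_treeD[OF le[OF rk]] Cons by metis
        then show ?thesis unfolding Cons by (rule S_dich)
      qed
    qed
  qed (rule pre')
  moreover have "x \<in> (\<Inter>n. \<Union>m. C n m) \<longleftrightarrow> ill_founded (prod_tree (S x)) []" for x
  proof
    show "ill_founded (prod_tree (S x)) []" if "x \<in> (\<Inter>n. \<Union>m. C n m)"
      by (rule ill_founded_prod_tree) (simp add: S_ill[OF that])
  qed (intro in_C ill_founded_rank_ge)
  ultimately show ?case
    by (intro exI[of _ "\<lambda>x. prod_tree (S x)"] conjI allI) simp_all
qed

lemma continuous_map_tree_topology:
  assumes "\<And>x. x \<in> topspace X \<Longrightarrow> T x \<in> Trees"
    and clop: "\<And>s. clopenin X {x \<in> topspace X. s \<in> T x}"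
  shows "continuous_map X tree_topology T"
proof -
  have "continuous_map X (discrete_topology UNIV) (\<lambda>x. s \<in> T x)" for s
    unfolding continuous_map_def
  proof (intro conjI allI impI)
    fix U :: "bool set"
    have "openin X (topspace X - {x \<in> topspace X. s \<in> T x})"
      using clop[of s] by (intro openin_diff) (auto simp: clopenin_def)
    also have "topspace X - {x \<in> topspace X. s \<in> T x} = {x \<in> topspace X. s \<notin> T x}" by blast
    finally have "openin X {x \<in> topspace X. s \<in> T x}" "openin X {x \<in> topspace X. s \<notin> T x}"
      using clop[of s] by (simp_all add: clopenin_def)
    moreover have "{x \<in> topspace X. (s \<in> T x) \<in> U} =
        (if True \<in> U then {x \<in> topspace X. s \<in> T x} else {}) \<union>
        (if False \<in> U then {x \<in> topspace X. s \<notin> T x} else {})"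
      by (auto split: if_splits) (metis (full_types))+
    ultimately show "openin X {x \<in> topspace X. (s \<in> T x) \<in> U}" by auto
  qed simp
  then show ?thesis
    unfolding tree_topology_def using assms(1)
    by (intro continuous_map_pullback') (auto simp: continuous_map_componentwise_UNIV comp_def)
qed

lemma Borel_Pi_hard_LT_less:
  "Borel_Pi_hard TYPE('x) tree_topology (ord_of_nat 2 * ord_succ \<alpha>)
    (LT_less (ord_omega * \<alpha> + ord_of_nat k + 1))"
  unfolding Borel_Pi_hard_def
proof (intro allI impI, elim conjE)
  fix X :: "'x topology" and A
  assume X: "Polish_space X" "zero_dimensional_space X"
    and A: "Borel_Pi X (ord_of_nat 2 * ord_succ \<alpha>) A"
  define \<gamma> where "\<gamma> = ord_omega * \<alpha> + ord_of_nat k"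
  have "ord_succ \<alpha> \<noteq> 0" using ord_succ_greater[of \<alpha>] by auto
  then have A': "even_Pi X (ord_succ \<alpha>) A"
    using A Borel_Pi_iff_even_Pi[OF X] by blast
  then obtain \<beta> C where C: "A = (\<Inter>n::nat. \<Union>m::nat. C n m)"
    and \<beta>: "\<beta> n \<le> \<alpha>" "even_Pi X (\<beta> n) (C n m)" for n m
    using even_Pi_succD by metis
  have "\<exists>T. (\<forall>s. clopenin X {x \<in> topspace X. s \<in> T x}) \<and>
    (\<forall>x. dichotomous (ord_omega * \<beta> n) (T x) \<and> (x \<in> C n m \<longleftrightarrow> ill_founded (T x) []))" for n m
    by (rule even_Pi_reduction[OF \<beta>(2)])
  then obtain T where T: "clopenin X {x \<in> topspace X. s \<in> T n m x}"
    "dichotomous (ord_omega * \<beta> n) (T n m x)" "x \<in> C n m \<longleftrightarrow> ill_founded (T n m x) []"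
    for n m s x
    by metis
  \<comment> \<open>Since \<open>\<beta> n \<le> \<alpha>\<close>, the single threshold \<gamma>
    serves for every \<open>n\<close>.\<close>
  have T_ill: "ill_founded (T n m x) s" if "rank_ge (T n m x) \<gamma> s" for n m x s
  proof -
    have "ord_omega * \<beta> n \<le> \<gamma>"
      using ord_mult_mono[OF \<beta>(1)] ord_le_add order_trans unfolding \<gamma>_def by blast
    then show ?thesis using that T(2) rank_ge_antimono unfolding dichotomous_def by blast
  qed
  obtain G :: "nat \<Rightarrow> nat list set" where G: "\<And>j. prefix_closed (G j)"
    "\<And>j. \<not> rank_ge (G j) \<gamma> []" "\<And>\<eta>. \<eta> < \<gamma> \<Longrightarrow> \<exists>j. rank_ge (G j) \<eta> []"
    using exists_trees_of_rank[of \<gamma>] by blast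
  have G_rank: "\<not> rank_ge (G j) \<gamma> s" for j s
    using G(2) rank_ge_append[OF G(1), of j \<gamma> "[]" s] by auto
  \<comment> \<open>Below the node \<open>[n]\<close>, the fixed trees \<open>G\<close> take the
    even places and the trees of the sets \<open>C n m\<close> the odd ones.\<close>
  define P where "P x n m = (if even m then G (m div 2) else T n (m div 2) x)" for x n m
  define F where "F x = graft (\<lambda>n. graft (P x n))" for x
  have P: "P x n (2 * j) = G j" "P x n (Suc (2 * j)) = T n j x" for x n j
    by (simp_all add: P_def)
  have P_ill: "ill_founded (P x n m) s" if "rank_ge (P x n m) \<gamma> s" for x n m s
    using that G_rank T_ill by (auto simp: P_def split: if_splits)
  have P_clop: "clopenin X {x \<in> topspace X. s \<in> P x n m}" for s n m
    using T(1) by (cases "even m"; cases "s \<in> G (m div 2)") (simp_all add: P_def clopenin_def)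
  have "F x \<in> Trees" for x
    using G(1) T(2) unfolding Trees_iff F_def
    by (auto simp: P_def dichotomous_def intro!: prefix_closed_graft)
  note Trees = this
  have "continuous_map X tree_topology F"
    using Trees P_clop unfolding F_def by (intro continuous_map_tree_topology clopenin_graft) auto
  moreover have "F x \<in> LT_less (\<gamma> + 1) \<longleftrightarrow> x \<in> A" for x
  proof
    assume F: "F x \<in> LT_less (\<gamma> + 1)"
    show "x \<in> A"
      unfolding C
    proof
      fix n
      \<comment> \<open>The trees \<open>G\<close> alone give \<open>[n]\<close> rank \<ge>
        \<gamma>. The height bound then forces a child of rank \<ge> \<gamma>, which can only sit at
        an odd place.\<close>
      have "rank_ge (F x) \<gamma> [n]"
        using G(3) P(1)[of x n] by (auto simp: F_def rank_ge_graft_Nil) metis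
      then have "rank_ge (F x) (ord_succ \<gamma>) [n]"
        using F by (simp add: LT_less_iff)
      then obtain m where m: "rank_ge (P x n m) \<gamma> []"
        using ord_succ_greater by (auto simp: F_def rank_ge_graft_Nil)
      then have "odd m" using G(2) by (auto simp: P_def)
      then have "ill_founded (T n (m div 2) x) []"
        using P_ill[OF m] by (simp add: P_def)
      then show "x \<in> (\<Union>m. C n m)" using T(3) by blast
    qed
  next
    assume "x \<in> A"
    have "ill_founded (graft (P x n)) []" for n
    proof -
      obtain m where "x \<in> C n m" using \<open>x \<in> A\<close> unfolding C by blast
      then have "ill_founded (T n m x) []" unfolding T(3) .
      then have "ill_founded (P x n (Suc (2 * m))) []" by (simp add: P)
      then show ?thesis unfolding ill_founded_graft_Nil by blast
    qed
    moreover have "ill_founded (graft (P x n)) (m # t)" if "rank_ge (graft (P x n)) \<gamma> (m # t)" for n m t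
      using that P_ill by simp
    \<comment> \<open>A nonempty node is either some \<open>[n]\<close>, ill-founded as
      \<open>x \<in> A\<close>, or lies inside some \<open>P x n m\<close>, where rank \<ge>
      \<gamma> suffices.\<close>
    ultimately have "ill_founded (F x) s" if "s \<noteq> []" "rank_ge (F x) \<gamma> s" for s
      using that unfolding F_def
      by (metis ill_founded_graft_Cons neq_Nil_conv rank_ge_graft_Cons)
    then show "F x \<in> LT_less (\<gamma> + 1)"
      using Trees by (simp add: LT_less_iff ill_founded_rank_ge)
  qed
  moreover have "A \<subseteq> topspace X" using even_Pi_subset[OF A'] .
  ultimately show "\<exists>f. continuous_map X tree_topology f \<and>
      {x \<in> topspace X. f x \<in> LT_less (ord_omega * \<alpha> + ord_of_nat k + 1)} = A"
    unfolding \<gamma>_def by (intro exI[of _ F]) auto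
qed

theorem theorem1p6:
  fixes \<alpha> :: countable_ord and k :: nat
  shows "Borel_Pi_complete TYPE('x) tree_topology
           (ord_of_nat 2 * \<alpha> + ord_of_nat 2)
           (LT_less (ord_omega * \<alpha> + ord_of_nat k + 1))"
proof -
  \<comment> \<open>Both halves are available at level 2(\<alpha> + 1), which unfolds to 2\<alpha> +
    2.\<close>
  have "ord_succ \<alpha> \<noteq> 0" using ord_succ_greater[of \<alpha>] by auto
  then show ?thesis
    using even_Pi_imp_Borel_Pi[OF even_Pi_LT_less] Borel_Pi_hard_LT_less[of \<alpha> k]
    by (simp add: Borel_Pi_complete_def)
qed

end
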